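(* Let $k\ge 1$, let $R=\{x+iy\in\mathbb{C}: -k<x<k,\ -1<y<1\}$ be the rectangle $[-k,k]\times[-1,1]$ (viewed as a domain), and let $\lambda\in(0,1)$ be the unique root of the equation $$\frac{K(\lambda)}{K'(\lambda)}=\frac{1}{2k}.$$ Set $$C(\lambda)=K(\lambda)\left|\frac{\operatorname{cn}(iK(\lambda),\lambda)\,\operatorname{dn}(iK(\lambda),\lambda)}{\operatorname{sn}(iK(\lambda),\lambda)}\right|.$$ Then for all $v\in R$ $$1<\frac{2d_R(v)}{r_R(v)}\le C(\lambda).$$ Both inequalities are sharp (i.e. $1$ cannot be replaced by a larger constant and $C(\lambda)$ cannot be replaced by a smaller one). Moreover, equality in the second inequality holds if and only if $v=k-1$ or $v=-(k-1)$.
   Context: For a proper subdomain $D$ of $\mathbb{C}$ and $z\in D$, $d_D(z)=\inf\{|z-\zeta|:\zeta\in\partial D\}$ is the Euclidean distance to the boundary. For a simply connected proper subdomain $D\subset\mathbb{C}$ and $z_0\in D$, the conformal radius $r_D(z_0)$ is $F'(0)$, where $F$ is the conformal map of the unit disk onto $D$ with $F(0)=z_0$, $F'(0)>0$ (equivalently, the radius of the disk centered at $0$ which can be mapped conformally onto $D$ by a function sending $0$ to $z_0$ with derivative $1$ at $0$). For $0<\lambda<1$, $$K(\lambda)=\int_0^1\frac{dt}{\sqrt{(1-t^2)(1-\lambda^2t^2)}},\qquad K'(\lambda)=K\bigl(\sqrt{1-\lambda^2}\bigr).$$ $\operatorname{sn}(\cdot,\lambda)$, $\operatorname{cn}(\cdot,\lambda)$,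 $\operatorname{dn}(\cdot,\lambda)$ are the Jacobi elliptic functions with modulus $\lambda$ (extended meromorphically to $\mathbb{C}$): $\operatorname{sn}(z,\lambda)=\sin\operatorname{am}(z,\lambda)$, $\operatorname{cn}(z,\lambda)=\cos\operatorname{am}(z,\lambda)$, $\operatorname{dn}(z,\lambda)=\frac{d}{dz}\operatorname{am}(z,\lambda)$, where $\varphi=\operatorname{am}(z,\lambda)$ is the inverse of $z=\int_0^\varphi \frac{d\theta}{\sqrt{1-\lambda^2\sin^2\theta}}$. *)

theory Defs
  imports "HOL-Complex_Analysis.Complex_Analysis"
begin

definition open_rectangle :: "real \<Rightarrow> complex set" where
  "open_rectangle k = {z. - k < Re z \<and> Re z < k \<and> - 1 < Im z \<and> Im z < 1}"

definition boundary_dist :: "complex set \<Rightarrow> complex \<Rightarrow> real" where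
  "boundary_dist D z = infdist z (frontier D)"

text \<open>Meaningful for a simply connected proper subdomain \<open>D\<close> of the plane and \<open>z0 \<in> D\<close>:
  then the Riemann map \<open>F\<close> exists and is unique.\<close>

definition conformal_radius :: "complex set \<Rightarrow> complex \<Rightarrow> real" where
  "conformal_radius D z0 = (THE r. 0 < r \<and>
     (\<exists>F. F holomorphic_on ball 0 1 \<and> bij_betw F (ball 0 1) D \<and>
          F 0 = z0 \<and> deriv F 0 = complex_of_real r))"

definition elliptic_K :: "real \<Rightarrow> real" where
  "elliptic_K l = (LBINT t=0..1. 1 / sqrt ((1 - t\<^sup>2) * (1 - l\<^sup>2 * t\<^sup>2)))"

definition elliptic_K' :: "real \<Rightarrow> real" where
  "elliptic_K' l = elliptic_K (sqrt (1 - l\<^sup>2))"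

text \<open>The interval integral is oriented, so this is an odd function of \<open>\<phi>\<close>;
  for \<open>0 < l < 1\<close> it is a bijection of the real line.\<close>

definition elliptic_F :: "real \<Rightarrow> real \<Rightarrow> real" where
  "elliptic_F l \<phi> = (LBINT \<theta>=0..\<phi>. 1 / sqrt (1 - l\<^sup>2 * (sin \<theta>)\<^sup>2))"

definition jacobi_am :: "real \<Rightarrow> real \<Rightarrow> real" where
  "jacobi_am l = inv (elliptic_F l)"

text \<open>The meromorphic function on the plane that extends \<open>g\<close> from the real line; it is
  unique if it exists. Being nicely meromorphic fixes the value at poles as \<open>0\<close> and
  excludes removable singularities.\<close>

definition meromorphic_extension :: "(real \<Rightarrow> real) \<Rightarrow> complex \<Rightarrow> complex" where
  "meromorphic_extension g = (THE f. f nicely_meromorphic_on UNIV \<and>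
     (\<forall>x. f (complex_of_real x) = complex_of_real (g x)))"

definition jacobi_sn :: "real \<Rightarrow> complex \<Rightarrow> complex" where
  "jacobi_sn l = meromorphic_extension (\<lambda>x. sin (jacobi_am l x))"

definition jacobi_cn :: "real \<Rightarrow> complex \<Rightarrow> complex" where
  "jacobi_cn l = meromorphic_extension (\<lambda>x. cos (jacobi_am l x))"

definition jacobi_dn :: "real \<Rightarrow> complex \<Rightarrow> complex" where
  "jacobi_dn l = meromorphic_extension (deriv (jacobi_am l))"

definition rectangle_const :: "real \<Rightarrow> real" where
  "rectangle_const l =
     (let w = \<i> * complex_of_real (elliptic_K l)
      in elliptic_K l * cmod (jacobi_cn l w * jacobi_dn l w / jacobi_sn l w))"

end

theory Submission
  imports Defs
begin

text \<open>
  Let \<open>r(v)\<close> be the conformal radius of the rectangle \<open>R\<close> at \<open>v\<close>. Everything about \<open>r\<close> follows from the Schwarz lemma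
  in the form of a comparison principle (\<open>conformal_radius_ge\<close>): a holomorphic map \<open>G\<close> of the unit disk into
  \<open>R\<close> with \<open>G(0) = v\<close> satisfies \<open>|G'(0)| \<le> r(v)\<close>, strictly unless \<open>G\<close> is a conformal map onto \<open>R\<close>. Dually
  (\<open>conformal_radius_le\<close>), a holomorphic map from \<open>R\<close> to the disk with a zero at \<open>v\<close> bounds \<open>r(v)\<close> from above.

  Lower bound. \<open>R\<close> is contained in the half-plane bounded by the line through its nearest side, and comparison
  with that half-plane gives \<open>r(v) < 2 d(v)\<close>. Comparison with the inscribed unit disk shows that the
  quotient tends to \<open>1\<close> when \<open>v = \<i> y\<close> and \<open>y\<close> tends to \<open>1\<close>.

  Upper bound. As \<open>R\<close> is convex, the convex combination \<open>(1 - t) F + t E\<close> of the normalized Riemann maps at \<open>v\<close> and \<open>w\<close>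
  maps the disk into \<open>R\<close>, so \<open>r\<close> is concave, and indeed strictly concave
  (\<open>conformal_radius_rectangle_strict_concave\<close>). Together with the symmetries of \<open>R\<close> this makes \<open>r\<close> strictly
  decreasing in \<open>|Re v|\<close> and in \<open>|Im v|\<close>. For a given distance \<open>m\<close> to the boundary, \<open>r\<close> is
  therefore smallest at the points \<open>\<plusminus>(k - m) \<plusminus> (1 - m) \<i>\<close>, which lie on the bisectors of the angles at the corners.
  Shrinking \<open>R\<close> towards the corner \<open>k + \<i>\<close> by the factor \<open>m < 1\<close> moves \<open>k - 1\<close> to such a point, whence \<open>r > m r(k - 1)\<close> there
  (\<open>conformal_radius_rectangle_bisector\<close>). So the quotient \<open>2 d / r\<close> is maximal exactly at
  \<open>\<plusminus>(k - 1)\<close>, with maximum \<open>2 / r(k - 1)\<close>.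

  Value of the maximum. For the modulus with \<open>K' = 2 k K\<close>, the map \<open>v \<mapsto> \<i> K (k - v)\<close> takes \<open>R\<close> to the
  rectangle \<open>|Re u| < K\<close>, \<open>0 < Im u < K'\<close>, which \<open>sn\<close> maps conformally onto the upper
  half-plane (\<open>cx_sn_bij\<close>), and it takes \<open>k - 1\<close> to \<open>\<i> K\<close>. Hence \<open>r(k - 1)\<close> can be read off from \<open>sn\<close> and \<open>sn' = cn dn\<close> at \<open>\<i> K\<close>.
  The meromorphic functions \<open>sn\<close>, \<open>cn\<close>, \<open>dn\<close> are constructed from the real ones of moduli \<open>l\<close> and
  \<open>sqrt (1 - l\<^sup>2)\<close> by the formulas that the addition theorem and Jacobi's imaginary transformation give for
  \<open>sn (x + \<i> y)\<close>. That they are meromorphic is checked through the Cauchy--Riemann equations, which are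
  polynomial identities; that \<open>sn\<close> is injective follows by inverting it with a primitive of
  \<open>1 / sqrt ((1 - w\<^sup>2) (1 - l\<^sup>2 w\<^sup>2))\<close> on the half-plane, and that it is onto by a
  compactness argument.
\<close>

section \<open>Conformal radius and the Schwarz lemma\<close>

text \<open>The Schwarz lemma for \<open>F\<inverse> \<circ> G\<close>. In the case of equality this map is a rotation, so \<open>G\<close> is conformal too.\<close>

lemma schwarz_comparison:
  assumes F: "F holomorphic_on ball 0 1" "bij_betw F (ball 0 1) D"
    and G: "G holomorphic_on ball 0 1" "G ` ball 0 1 \<subseteq> D" "G 0 = F 0"
  shows "cmod (deriv G 0) \<le> cmod (deriv F 0)"
    and "cmod (deriv G 0) = cmod (deriv F 0) \<Longrightarrow> bij_betw G (ball 0 1) D"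
proof -
  have inj: "inj_on F (ball 0 1)" and img: "F ` ball 0 1 = D"
    using F(2) by (auto simp: bij_betw_def)
  obtain h where h: "h holomorphic_on D"
      "\<And>z. z \<in> ball 0 1 \<Longrightarrow> deriv F z * deriv h (F z) = 1"
      "\<And>z. z \<in> ball 0 1 \<Longrightarrow> h (F z) = z"
    using holomorphic_has_inverse [OF F(1) open_ball inj] img by metis
  have D: "open D"
    using open_mapping_thm3 [OF F(1) open_ball inj] img by simp
  have Fh: "F (h w) = w" "h w \<in> ball 0 1" if "w \<in> D" for w
    using that h(3) img by force+
  have FD: "F 0 \<in> D" using img by force
  define H where "H = h \<circ> G"
  have hol: "H holomorphic_on ball 0 1"
    unfolding H_def by (rule holomorphic_on_compose_gen [OF G(1) h(1) G(2)])
  have H0: "H 0 = 0"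
    using h(3)[of 0] G(3) by (simp add: H_def)
  have no: "cmod (H z) < 1" if "cmod z < 1" for z
  proof -
    have "G z \<in> D" using G(2) that by auto
    thus ?thesis using Fh(2)[of "G z"] by (simp add: H_def)
  qed
  have dH: "deriv H 0 = deriv h (F 0) * deriv G 0"
  proof -
    have "h field_differentiable at (G 0)"
      using FD by (intro holomorphic_on_imp_differentiable_at [OF h(1) D]) (simp add: G(3))
    moreover have "G field_differentiable at 0"
      using G by (intro holomorphic_on_imp_differentiable_at [OF G(1)]) auto
    ultimately show ?thesis
      unfolding H_def using G(3) by (simp add: deriv_chain)
  qed
  have FG: "cmod (deriv G 0) = cmod (deriv F 0) * cmod (deriv H 0)"
  proof -
    have "deriv F 0 * deriv H 0 = deriv G 0"
      using h(2)[of 0] by (simp add: dH mult.assoc [symmetric])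
    thus ?thesis by (metis norm_mult)
  qed
  have nz: "deriv F 0 \<noteq> 0"
    using h(2)[of 0] by auto
  show "cmod (deriv G 0) \<le> cmod (deriv F 0)"
    using Schwarz_Lemma(2)[OF hol H0 no, of 0] by (simp add: FG mult_left_le)
  assume "cmod (deriv G 0) = cmod (deriv F 0)"
  hence "cmod (deriv H 0) = 1"
    using FG nz by simp
  then obtain \<alpha> where \<alpha>: "\<forall>z. norm z < 1 \<longrightarrow> H z = \<alpha> * z" "norm \<alpha> = 1"
    using Schwarz_Lemma(3)[OF hol H0 no, of 0] by auto
  have "w \<in> G ` ball 0 1" if w: "w \<in> D" for w
  proof -
    define z where "z = h w / \<alpha>"
    have z: "z \<in> ball 0 1" "\<alpha> * z = h w"
      using Fh(2)[OF w] \<alpha>(2) by (auto simp: z_def norm_divide)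
    hence "h (G z) = h w"
      using \<alpha>(1) by (simp add: H_def)
    moreover have "G z \<in> D" using G(2) z by auto
    ultimately have "G z = w"
      using Fh(1) w by metis
    thus ?thesis using z by blast
  qed
  hence "G ` ball 0 1 = D" using G(2) by blast
  moreover have "inj_on G (ball 0 1)"
  proof (rule inj_onI)
    fix z w assume "z \<in> ball 0 1" "w \<in> ball 0 1" "G z = G w"
    hence "\<alpha> * z = \<alpha> * w"
      using \<alpha>(1) by (metis H_def comp_apply mem_ball_0)
    thus "z = w" using \<alpha>(2) by auto
  qed
  ultimately show "bij_betw G (ball 0 1) D" by (simp add: bij_betw_def)
qed

text \<open>Two normalized Riemann maps have the same derivative at \<open>0\<close>, so the description in the definition of
  the conformal radius picks out a unique number.\<close>

lemma conformal_radius_eqI: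
  assumes "F holomorphic_on ball 0 1" "bij_betw F (ball 0 1) D" "F 0 = v"
    "deriv F 0 = complex_of_real r" "0 < r"
  shows "conformal_radius D v = r"
  unfolding conformal_radius_def
proof (rule the_equality)
  show "0 < r \<and> (\<exists>F. F holomorphic_on ball 0 1 \<and> bij_betw F (ball 0 1) D \<and> F 0 = v \<and>
          deriv F 0 = complex_of_real r)"
    using assms by blast
next
  fix s assume s: "0 < s \<and> (\<exists>F. F holomorphic_on ball 0 1 \<and> bij_betw F (ball 0 1) D \<and> F 0 = v \<and>
          deriv F 0 = complex_of_real s)"
  then obtain E where E: "E holomorphic_on ball 0 1" "bij_betw E (ball 0 1) D" "E 0 = v"
    "deriv E 0 = complex_of_real s" by blast
  have "cmod (deriv E 0) \<le> cmod (deriv F 0)"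
    by (rule schwarz_comparison(1)[OF assms(1,2) E(1)]) (use E assms in \<open>auto simp: bij_betw_def\<close>)
  moreover have "cmod (deriv F 0) \<le> cmod (deriv E 0)"
    by (rule schwarz_comparison(1)[OF E(1,2) assms(1)]) (use E assms in \<open>auto simp: bij_betw_def\<close>)
  ultimately show "s = r" using s assms E by simp
qed

lemma riemann_map_normalized:
  assumes D: "open D" "simply_connected D" "D \<noteq> UNIV" and v: "v \<in> D"
  obtains F r where "F holomorphic_on ball 0 1" "bij_betw F (ball 0 1) D" "F 0 = v"
    "deriv F 0 = complex_of_real r" "0 < r"
proof -
  obtain f g where fg: "f holomorphic_on D" "g holomorphic_on ball 0 1"
     "\<forall>z\<in>D. f z \<in> ball 0 1 \<and> g (f z) = z" "\<forall>z\<in>ball 0 1. g z \<in> D \<and> f (g z) = z"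
    using D v simply_connected_eq_biholomorphic_to_disc [OF D(1)] by blast
  define a where "a = f v"
  have a: "cmod a < 1" using fg(3) v by (simp add: a_def)
  let ?M = "Moebius_function 0 (-a)"
  let ?N = "Moebius_function 0 a"
  have M: "?M holomorphic_on ball 0 1" "?M ` ball 0 1 \<subseteq> ball 0 1" "?M 0 = a"
    using a by (auto intro!: Moebius_function_holomorphic Moebius_function_norm_lt_1
        simp: Moebius_function_of_zero)
  have N: "cmod z < 1 \<Longrightarrow> cmod (?N z) < 1 \<and> ?M (?N z) = z \<and> ?N (?M z) = z" for z
    using a by (auto intro!: Moebius_function_norm_lt_1 Moebius_function_compose)
  define E where "E = g \<circ> ?M"
  have E: "E holomorphic_on ball 0 1"
    unfolding E_def by (rule holomorphic_on_compose_gen [OF M(1) fg(2) M(2)])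
  have bij: "bij_betw E (ball 0 1) D"
    by (rule bij_betw_byWitness[where f' = "?N \<circ> f"]) (use fg M N in \<open>auto simp: E_def\<close>)
  have E0: "E 0 = v" using M(3) fg v by (simp add: E_def a_def)
  define \<rho> where "\<rho> = deriv E 0"
  have \<rho>: "\<rho> \<noteq> 0"
    unfolding \<rho>_def
    by (rule holomorphic_injective_imp_regular [OF E open_ball]) (use bij in \<open>auto simp: bij_betw_def\<close>)
  \<comment> \<open>the rotation that makes the derivative at \<open>0\<close> positive\<close>
  define u where "u = cnj \<rho> / cmod \<rho>"
  have u: "cmod u = 1" "u \<noteq> 0" using \<rho> by (auto simp: u_def norm_divide)
  define F where "F = E \<circ> (\<lambda>z. u * z)"
  have um: "(\<lambda>z. u * z) ` ball 0 1 \<subseteq> ball 0 1" using u by (auto simp: norm_mult)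
  have "F holomorphic_on ball 0 1"
    unfolding F_def by (rule holomorphic_on_compose_gen [OF _ E um]) (intro holomorphic_intros)
  moreover have "bij_betw F (ball 0 1) D"
    unfolding F_def
  proof (rule bij_betw_trans [OF _ bij])
    show "bij_betw (\<lambda>z. u * z) (ball 0 1) (ball 0 1)"
      by (rule bij_betw_byWitness[where f' = "\<lambda>z. z / u"]) (use u um in \<open>auto simp: norm_divide\<close>)
  qed
  moreover have "F 0 = v" by (simp add: F_def E0)
  moreover have "deriv F 0 = complex_of_real (cmod \<rho>)"
  proof -
    have "(E has_field_derivative \<rho>) (at (u * 0))"
      using holomorphic_derivI [OF E open_ball, of 0] by (simp add: \<rho>_def)
    hence "(F has_field_derivative \<rho> * u) (at 0)"
      unfolding F_def by (rule DERIV_chain) (auto intro!: derivative_eq_intros)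
    moreover have "\<rho> * u = cmod \<rho>"
      using \<rho> by (simp add: u_def complex_norm_square [symmetric] power2_eq_square)
    ultimately show ?thesis by (simp add: DERIV_imp_deriv)
  qed
  ultimately show ?thesis using that \<rho> by auto
qed

context
  fixes D :: "complex set" and v :: complex
  assumes D: "open D" "simply_connected D" "D \<noteq> UNIV" and v: "v \<in> D"
begin

lemma conformal_radius_pos: "0 < conformal_radius D v"
  using riemann_map_normalized [OF D v] conformal_radius_eqI by metis

lemma conformal_radius_ge:
  assumes G: "G holomorphic_on ball 0 1" "G ` ball 0 1 \<subseteq> D" "G 0 = v"
  shows "cmod (deriv G 0) \<le> conformal_radius D v"
    and "\<not> bij_betw G (ball 0 1) D \<Longrightarrow> cmod (deriv G 0) < conformal_radius D v"
proof -
  obtain F r where F: "F holomorphic_on ball 0 1" "bij_betw F (ball 0 1) D" "F 0 = v"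
    "deriv F 0 = complex_of_real r" "0 < r"
    by (rule riemann_map_normalized [OF D v])
  have r: "conformal_radius D v = r" by (rule conformal_radius_eqI [OF F])
  show *: "cmod (deriv G 0) \<le> conformal_radius D v"
    using schwarz_comparison(1)[OF F(1,2) G(1,2)] F G r by simp
  show "cmod (deriv G 0) < conformal_radius D v" if "\<not> bij_betw G (ball 0 1) D"
    using schwarz_comparison(2)[OF F(1,2) G(1,2)] F G r that * by fastforce
qed

lemma conformal_radius_le:
  assumes \<phi>: "\<phi> holomorphic_on D" "\<phi> ` D \<subseteq> ball 0 1" "\<phi> v = 0"
  shows "conformal_radius D v * cmod (deriv \<phi> v) \<le> 1"
    and "\<phi> ` D \<noteq> ball 0 1 \<Longrightarrow> conformal_radius D v * cmod (deriv \<phi> v) < 1"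
proof -
  obtain F r where F: "F holomorphic_on ball 0 1" "bij_betw F (ball 0 1) D" "F 0 = v"
    "deriv F 0 = complex_of_real r" "0 < r"
    by (rule riemann_map_normalized [OF D v])
  have r: "conformal_radius D v = r" by (rule conformal_radius_eqI [OF F])
  have img: "F ` ball 0 1 = D" using F(2) by (simp add: bij_betw_def)
  define H where "H = \<phi> \<circ> F"
  have hol: "H holomorphic_on ball 0 1"
    unfolding H_def by (rule holomorphic_on_compose_gen [OF F(1) \<phi>(1)]) (use img in auto)
  have "deriv H 0 = deriv \<phi> v * deriv F 0"
  proof -
    have "\<phi> field_differentiable at (F 0)"
      using F v by (intro holomorphic_on_imp_differentiable_at [OF \<phi>(1) D(1)]) auto
    moreover have "F field_differentiable at 0"
      by (intro holomorphic_on_imp_differentiable_at [OF F(1)]) auto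
    ultimately show ?thesis
      unfolding H_def using F(3) by (simp add: deriv_chain)
  qed
  hence dH: "cmod (deriv H 0) = conformal_radius D v * cmod (deriv \<phi> v)"
    using F r by (simp add: norm_mult)
  have H: "H ` ball 0 1 = \<phi> ` D" using img by (auto simp: H_def)
  have H0: "H 0 = id 0" using F \<phi> by (simp add: H_def)
  have "H ` ball 0 1 \<subseteq> ball 0 1" using \<phi> H by auto
  note sc = schwarz_comparison[OF holomorphic_on_id bij_betw_id hol this H0]
  show *: "conformal_radius D v * cmod (deriv \<phi> v) \<le> 1"
    using sc(1) by (simp add: dH)
  show "conformal_radius D v * cmod (deriv \<phi> v) < 1" if "\<phi> ` D \<noteq> ball 0 1"
    using sc(2) that H * by (fastforce simp: dH bij_betw_def)
qed

text \<open>Any Riemann map onto the disk that vanishes at \<open>v\<close> computes the conformal radius.\<close>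

lemma conformal_radius_eq_inverse_deriv:
  assumes \<phi>: "\<phi> holomorphic_on D" "bij_betw \<phi> D (ball 0 1)" "\<phi> v = 0"
  shows "conformal_radius D v * cmod (deriv \<phi> v) = 1"
proof (rule antisym)
  have inj: "inj_on \<phi> D" and img: "\<phi> ` D = ball 0 1"
    using \<phi>(2) by (auto simp: bij_betw_def)
  show "conformal_radius D v * cmod (deriv \<phi> v) \<le> 1"
    by (rule conformal_radius_le) (use \<phi> img in auto)
  obtain g where g: "g holomorphic_on ball 0 1"
     "\<And>z. z \<in> D \<Longrightarrow> deriv \<phi> z * deriv g (\<phi> z) = 1"  "\<And>z. z \<in> D \<Longrightarrow> g (\<phi> z) = z"
    using holomorphic_has_inverse [OF \<phi>(1) D(1) inj] img by metis
  have "g ` ball 0 1 \<subseteq> D" using g(3) by (auto simp flip: img)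
  hence "cmod (deriv g 0) \<le> conformal_radius D v"
    using g(3)[OF v] \<phi>(3) by (intro conformal_radius_ge g) auto
  hence "cmod (deriv g 0) * cmod (deriv \<phi> v) \<le> conformal_radius D v * cmod (deriv \<phi> v)"
    by (rule mult_right_mono) simp
  moreover have "cmod (deriv \<phi> v) * cmod (deriv g 0) = 1"
    using g(2)[OF v] \<phi>(3) by (metis norm_mult norm_one)
  ultimately show "1 \<le> conformal_radius D v * cmod (deriv \<phi> v)" by (simp add: mult.commute)
qed

end

section \<open>The conformal radius of a rectangle\<close>

lemma open_rectangle_eq_box: "open_rectangle k = box (Complex (-k) (-1)) (Complex k 1)"
  by (auto simp: open_rectangle_def in_box_complex_iff)

lemma mem_open_rectangle: "v \<in> open_rectangle k \<longleftrightarrow> \<bar>Re v\<bar> < k \<and> \<bar>Im v\<bar> < 1"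
  by (auto simp: open_rectangle_def)

lemma open_rectangle:
  shows "open (open_rectangle k)" "convex (open_rectangle k)" "bounded (open_rectangle k)"
    "simply_connected (open_rectangle k)" "open_rectangle k \<noteq> UNIV"
proof -
  show "open (open_rectangle k)" "convex (open_rectangle k)" and b: "bounded (open_rectangle k)"
    unfolding open_rectangle_eq_box by (auto simp: bounded_box convex_box)
  thus "simply_connected (open_rectangle k)" by (simp add: convex_imp_simply_connected)
  show "open_rectangle k \<noteq> UNIV" using b not_bounded_UNIV by metis
qed

lemma boundary_dist_rectangle:
  assumes v: "v \<in> open_rectangle k"
  shows "boundary_dist (open_rectangle k) v = min (k - \<bar>Re v\<bar>) (1 - \<bar>Im v\<bar>)" (is "_ = ?m")
proof -
  have k: "k > 0" using v by (auto simp: mem_open_rectangle)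
  let ?R = "open_rectangle k"
  have ne: "box (Complex (-k) (-1)) (Complex k 1) \<noteq> {}"
    using v by (auto simp: open_rectangle_eq_box)
  have fr: "p \<in> frontier ?R \<longleftrightarrow> \<bar>Re p\<bar> \<le> k \<and> \<bar>Im p\<bar> \<le> 1 \<and> (\<bar>Re p\<bar> = k \<or> \<bar>Im p\<bar> = 1)" for p
  proof -
    have "frontier ?R = cbox (Complex (-k) (-1)) (Complex k 1) - ?R"
      unfolding frontier_def open_rectangle_eq_box using ne by (simp add: interior_open [OF open_box])
    thus ?thesis by (auto simp: in_cbox_complex_iff mem_open_rectangle)
  qed
  have le: "infdist v (frontier ?R) \<le> dist v p" if "\<bar>Re p\<bar> \<le> k" "\<bar>Im p\<bar> \<le> 1" "\<bar>Re p\<bar> = k \<or> \<bar>Im p\<bar> = 1" for p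
    using that by (intro infdist_le) (simp add: fr)
  have "infdist v (frontier ?R) \<ge> ?m"
  proof -
    have "Complex k 0 \<in> frontier ?R" using k by (simp add: fr)
    hence "frontier ?R \<noteq> {}" by blast
    moreover have "?m \<le> dist v p" if p: "p \<in> frontier ?R" for p
    proof -
      have "\<bar>Re v - Re p\<bar> \<le> dist v p" "\<bar>Im v - Im p\<bar> \<le> dist v p"
        using abs_Re_le_cmod[of "v - p"] abs_Im_le_cmod[of "v - p"] by (auto simp: dist_norm)
      thus ?thesis using p unfolding fr min_le_iff_disj by argo
    qed
    ultimately show ?thesis by (auto simp: infdist_def intro!: cINF_greatest)
  qed
  moreover have "infdist v (frontier ?R) \<le> k - \<bar>Re v\<bar>"
  proof -
    define p where "p = Complex (if Re v \<ge> 0 then k else -k) (Im v)"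
    have "dist v p = k - \<bar>Re v\<bar>"
      using v k by (auto simp: p_def dist_norm cmod_def mem_open_rectangle)
    thus ?thesis using le[of p] v k by (auto simp: p_def mem_open_rectangle)
  qed
  moreover have "infdist v (frontier ?R) \<le> 1 - \<bar>Im v\<bar>"
  proof -
    define p where "p = Complex (Re v) (if Im v \<ge> 0 then 1 else -1)"
    have "dist v p = 1 - \<bar>Im v\<bar>"
      using v k by (auto simp: p_def dist_norm cmod_def mem_open_rectangle)
    thus ?thesis using le[of p] v k by (auto simp: p_def mem_open_rectangle)
  qed
  ultimately show ?thesis unfolding boundary_dist_def by simp
qed

text \<open>With \<open>v'\<close> the mirror image of \<open>v\<close> in the boundary line of the half-plane, \<open>w \<mapsto> (w - v) / (w - v')\<close> maps
  the half-plane to the unit disk. A bounded \<open>D\<close> is not mapped onto the disk, so the inequality is strict.\<close>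

lemma conformal_radius_less_halfplane:
  assumes D: "open D" "simply_connected D" "bounded D" and v: "v \<in> D" and u: "cmod u = 1"
    and sub: "\<And>w. w \<in> D \<Longrightarrow> Re (cnj u * w) < h"
  shows "conformal_radius D v < 2 * (h - Re (cnj u * v))"
proof -
  define \<delta> where "\<delta> = h - Re (cnj u * v)"
  have \<delta>: "\<delta> > 0" using sub[OF v] by (simp add: \<delta>_def)
  define v' where "v' = v + of_real (2 * \<delta>) * u"
  have uu: "u * cnj u = 1" "cnj u * u = 1"
    using u by (auto simp: complex_norm_square [symmetric] mult.commute)
  have uu': "u * (cnj u * x) = x" for x using uu(1) by (simp add: mult.assoc [symmetric])
  have less: "cmod (w - v) < cmod (w - v')" if w: "w \<in> D" for w
  proof -
    define z where "z = cnj u * (w - v)"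
    have z: "w - v = u * z" "w - v' = u * (z - of_real (2 * \<delta>))"
      by (simp_all add: z_def v'_def right_diff_distrib uu')
    have "Re z < \<delta>" using sub[OF w] by (simp add: z_def \<delta>_def algebra_simps)
    hence "(Re z)\<^sup>2 + (Im z)\<^sup>2 < (Re z - 2 * \<delta>)\<^sup>2 + (Im z)\<^sup>2"
      using \<delta> by (simp add: power2_eq_square algebra_simps)
    hence "cmod z < cmod (z - of_real (2 * \<delta>))" by (simp add: cmod_def)
    thus ?thesis using u by (simp add: z norm_mult)
  qed
  define \<phi> where "\<phi> w = (w - v) / (w - v')" for w
  have vv: "cmod (v - v') = 2 * \<delta>" using \<delta> u by (simp add: v'_def norm_mult)
  have nz: "w - v' \<noteq> 0" if "w \<in> D" for w using less[OF that] by auto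
  have hol: "\<phi> holomorphic_on D" unfolding \<phi>_def by (intro holomorphic_intros nz)
  have img: "\<phi> ` D \<subseteq> ball 0 1"
  proof safe
    fix w assume "w \<in> D"
    thus "\<phi> w \<in> ball 0 1" using less[of w] nz[of w] by (simp add: \<phi>_def norm_divide)
  qed
  have d: "cmod (deriv \<phi> v) = 1 / (2 * \<delta>)"
  proof -
    have "(\<phi> has_field_derivative 1 / (v - v')) (at v)"
      unfolding \<phi>_def using nz[OF v] by (auto intro!: derivative_eq_intros)
    thus ?thesis using vv by (simp add: DERIV_imp_deriv norm_divide)
  qed
  have "\<phi> ` D \<noteq> ball 0 1"
  proof
    assume eq: "\<phi> ` D = ball 0 1"
    obtain M where M: "\<And>w. w \<in> D \<Longrightarrow> dist v w \<le> M" "M \<ge> 0"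
      using D(3) v by (metis bounded_any_center dist_self order_refl)
    \<comment> \<open>a value in the disk that \<open>\<phi>\<close> takes only at distance \<open>M + 2 \<delta>\<close> from \<open>v\<close>\<close>
    define s where "s = (M + 2 * \<delta>) / (M + 4 * \<delta>)"
    have s: "0 < s" "s < 1" "1 - s = 2 * \<delta> / (M + 4 * \<delta>)" using \<delta> M(2) by (auto simp: s_def field_simps)
    have "complex_of_real s \<in> \<phi> ` D" using eq s by simp
    then obtain w where w: "w \<in> D" "\<phi> w = of_real s" by auto
    have "w - v = of_real s * (w - v')" using w nz by (auto simp: \<phi>_def field_simps)
    hence "of_real (1 - s) * (w - v) = of_real s * (v - v')" by (simp add: algebra_simps)
    hence "cmod (of_real (1 - s) * (w - v)) = cmod (of_real s * (v - v'))" by (rule arg_cong)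
    hence "(1 - s) * cmod (w - v) = s * (2 * \<delta>)"
      using s(1,2) vv unfolding norm_mult norm_of_real by simp
    hence "2 * \<delta> * cmod (w - v) = 2 * \<delta> * (M + 2 * \<delta>)"
      using \<delta> M(2) unfolding s(3) by (simp add: s_def field_simps)
    hence "cmod (w - v) = M + 2 * \<delta>" using \<delta> by simp
    thus False using M(1)[OF w(1)] \<delta> by (simp add: dist_norm norm_minus_commute)
  qed
  moreover have "D \<noteq> UNIV" using D(3) not_bounded_UNIV by metis
  ultimately have "conformal_radius D v * cmod (deriv \<phi> v) < 1"
    by (intro conformal_radius_le D v hol img) (auto simp: \<phi>_def)
  hence "conformal_radius D v < 2 * \<delta>" using \<delta> by (simp add: d field_simps)
  thus ?thesis unfolding \<delta>_def .
qed

lemma conformal_radius_rectangle_less: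
  assumes v: "v \<in> open_rectangle k"
  shows "conformal_radius (open_rectangle k) v < 2 * boundary_dist (open_rectangle k) v"
proof -
  have *: "conformal_radius (open_rectangle k) v < 2 * (h - Re (cnj u * v))"
    if "cmod u = 1" "\<And>w. w \<in> open_rectangle k \<Longrightarrow> Re (cnj u * w) < h" for u h
    by (rule conformal_radius_less_halfplane) (use open_rectangle v that in auto)
  show ?thesis
    unfolding boundary_dist_rectangle[OF v]
    using *[of 1 k] *[of "-1" k] *[of \<i> 1] *[of "-\<i>" 1]
    by (simp add: open_rectangle_def abs_real_def min_def split: if_splits)
qed

text \<open>Comparison with the unit disk, which lies in the rectangle.\<close>

lemma conformal_radius_rectangle_ge:
  assumes k: "k \<ge> 1" and y: "\<bar>y\<bar> < 1"
  shows "1 - y\<^sup>2 \<le> conformal_radius (open_rectangle k) (\<i> * of_real y)"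
proof -
  let ?w = "\<i> * complex_of_real y"
  let ?M = "Moebius_function 0 (- ?w)"
  have w: "cmod (- ?w) < 1" using y by (simp add: norm_mult)
  have "ball 0 1 \<subseteq> open_rectangle k"
  proof
    fix z :: complex assume "z \<in> ball 0 1"
    thus "z \<in> open_rectangle k"
      using k abs_Re_le_cmod[of z] abs_Im_le_cmod[of z] by (auto simp: mem_open_rectangle)
  qed
  moreover have "?M ` ball 0 1 \<subseteq> ball 0 1" using Moebius_function_norm_lt_1[OF w] by auto
  ultimately have sub: "?M ` ball 0 1 \<subseteq> open_rectangle k" by blast
  have "(?M has_field_derivative complex_of_real (1 - y\<^sup>2)) (at 0)"
    unfolding Moebius_function_simple [abs_def]
    by (auto intro!: derivative_eq_intros simp: power2_eq_square algebra_simps)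
  hence d: "deriv ?M 0 = complex_of_real (1 - y\<^sup>2)" by (rule DERIV_imp_deriv)
  have "cmod (deriv ?M 0) \<le> conformal_radius (open_rectangle k) ?w"
    by (rule conformal_radius_ge)
       (use open_rectangle sub w Moebius_function_holomorphic[OF w] k y
          in \<open>auto simp: Moebius_function_of_zero mem_open_rectangle\<close>)
  moreover have "y\<^sup>2 \<le> 1" using y by (simp add: abs_square_le_1)
  ultimately show ?thesis unfolding d norm_of_real by simp
qed

lemma conformal_radius_rectangle_uminus:
  assumes v: "v \<in> open_rectangle k"
  shows "conformal_radius (open_rectangle k) (- v) = conformal_radius (open_rectangle k) v"
proof -
  obtain F r where F: "F holomorphic_on ball 0 1" "bij_betw F (ball 0 1) (open_rectangle k)" "F 0 = v"
    "deriv F 0 = complex_of_real r" "0 < r"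
    using riemann_map_normalized [OF open_rectangle(1,4,5) v] by blast
  have "conformal_radius (open_rectangle k) (- v) = r"
  proof (rule conformal_radius_eqI)
    have "F \<circ> uminus holomorphic_on ball 0 1"
      by (rule holomorphic_on_compose_gen [OF _ F(1)]) (auto intro!: holomorphic_intros)
    thus "uminus \<circ> (F \<circ> uminus) holomorphic_on ball 0 1"
      by (rule holomorphic_on_compose) (auto intro!: holomorphic_intros)
    have "bij_betw uminus (ball 0 1) (ball (0::complex) 1)"
      by (rule bij_betw_byWitness[where f' = uminus]) auto
    moreover have "bij_betw uminus (open_rectangle k) (open_rectangle k)"
      by (rule bij_betw_byWitness[where f' = uminus]) (auto simp: mem_open_rectangle)
    ultimately show "bij_betw (uminus \<circ> (F \<circ> uminus)) (ball 0 1) (open_rectangle k)"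
      by (meson bij_betw_trans F(2))
    have "(F has_field_derivative of_real r) (at (- 0))"
      using holomorphic_derivI [OF F(1) open_ball, of 0] F(4) by simp
    hence "(F \<circ> uminus has_field_derivative of_real r * (- 1)) (at 0)"
      by (rule DERIV_chain) (intro derivative_intros)
    hence "(uminus \<circ> (F \<circ> uminus) has_field_derivative (- 1) * (of_real r * (- 1))) (at 0)"
      by (rule DERIV_chain [rotated]) (intro derivative_intros)
    thus "deriv (uminus \<circ> (F \<circ> uminus)) 0 = of_real r" by (simp add: DERIV_imp_deriv)
  qed (use F in auto)
  moreover have "conformal_radius (open_rectangle k) v = r" by (rule conformal_radius_eqI [OF F])
  ultimately show ?thesis by simp
qed

lemma conformal_radius_rectangle_cnj:
  assumes v: "v \<in> open_rectangle k"
  shows "conformal_radius (open_rectangle k) (cnj v) = conformal_radius (open_rectangle k) v"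
proof -
  obtain F r where F: "F holomorphic_on ball 0 1" "bij_betw F (ball 0 1) (open_rectangle k)" "F 0 = v"
    "deriv F 0 = complex_of_real r" "0 < r"
    using riemann_map_normalized [OF open_rectangle(1,4,5) v] by blast
  have "conformal_radius (open_rectangle k) (cnj v) = r"
  proof (rule conformal_radius_eqI)
    have bb: "bij_betw cnj (ball 0 1) (ball (0::complex) 1)"
      by (rule bij_betw_byWitness[where f' = cnj]) auto
    hence "F holomorphic_on cnj ` ball 0 1" using F(1) by (simp add: bij_betw_def)
    thus "cnj \<circ> F \<circ> cnj holomorphic_on ball 0 1"
      by (rule holomorphic_on_compose_cnj_cnj) simp
    have "bij_betw cnj (open_rectangle k) (open_rectangle k)"
      by (rule bij_betw_byWitness[where f' = cnj]) (auto simp: mem_open_rectangle)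
    thus "bij_betw (cnj \<circ> F \<circ> cnj) (ball 0 1) (open_rectangle k)"
      by (intro bij_betw_trans [OF bb] bij_betw_trans [OF F(2)])
    have "(F has_field_derivative of_real r) (at 0)"
      using holomorphic_derivI [OF F(1) open_ball, of 0] F(4) by simp
    hence "(cnj \<circ> F \<circ> cnj has_field_derivative cnj (of_real r)) (at 0)"
      using has_field_derivative_cnj_cnj[of F "of_real r" 0] by simp
    thus "deriv (cnj \<circ> F \<circ> cnj) 0 = of_real r" by (simp add: DERIV_imp_deriv)
  qed (use F in auto)
  moreover have "conformal_radius (open_rectangle k) v = r" by (rule conformal_radius_eqI [OF F])
  ultimately show ?thesis by simp
qed

lemma conformal_radius_rectangle_abs:
  assumes "Complex x y \<in> open_rectangle k"
  shows "conformal_radius (open_rectangle k) (Complex \<bar>x\<bar> \<bar>y\<bar>) = conformal_radius (open_rectangle k) (Complex x y)"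
proof -
  let ?r = "conformal_radius (open_rectangle k)"
  have m: "Complex x (-y) \<in> open_rectangle k" "Complex x y \<in> open_rectangle k"
    using assms by (auto simp: mem_open_rectangle)
  have "?r (Complex x (-y)) = ?r (Complex x y)" "?r (Complex (-x) (-y)) = ?r (Complex x y)"
       "?r (Complex (-x) y) = ?r (Complex x (-y))"
    using conformal_radius_rectangle_cnj[OF m(2)] conformal_radius_rectangle_uminus[OF m(2)]
          conformal_radius_rectangle_uminus[OF m(1)]
    by (auto simp: complex_cnj complex_minus)
  thus ?thesis by (auto simp: abs_if)
qed

section \<open>Concavity of the conformal radius\<close>

text \<open>Concavity is immediate from the comparison principle. For strictness, suppose that \<open>G = (1 - t) F + t E\<close> is conformal
  onto the rectangle, and put \<open>B = E - F\<close>. Near the unit circle \<open>G\<close> approaches the boundary of the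
  rectangle, where its real or imaginary part is extremal; then the same part of \<open>F\<close> and \<open>E\<close> has to be nearly extremal
  as well, so \<open>Re B\<close> or \<open>Im B\<close> is nearly \<open>0\<close>. Thus the bounded harmonic function
  \<open>Im (B\<^sup>2) = 2 Re B Im B\<close> has boundary values \<open>0\<close>, so it vanishes and \<open>B\<close> is constant.
  But then the rectangle would be invariant under the translation by \<open>w - v \<noteq> 0\<close>.\<close>

lemma conformal_radius_rectangle_strict_concave:
  assumes v: "v \<in> open_rectangle k" and w: "w \<in> open_rectangle k" and vw: "v \<noteq> w"
    and t: "0 < t" "t < 1"
  shows "(1 - t) * conformal_radius (open_rectangle k) v + t * conformal_radius (open_rectangle k) w
    < conformal_radius (open_rectangle k) (of_real (1 - t) * v + of_real t * w)"
proof -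
  let ?R = "open_rectangle k" and ?B = "ball (0::complex) 1"
  have k: "k > 0" using v by (auto simp: mem_open_rectangle)
  obtain F r where F: "F holomorphic_on ?B" "bij_betw F ?B ?R" "F 0 = v"
    "deriv F 0 = complex_of_real r" "0 < r"
    using riemann_map_normalized [OF open_rectangle(1,4,5) v] by blast
  obtain E s where E: "E holomorphic_on ?B" "bij_betw E ?B ?R" "E 0 = w"
    "deriv E 0 = complex_of_real s" "0 < s"
    using riemann_map_normalized [OF open_rectangle(1,4,5) w] by blast
  have rs: "conformal_radius ?R v = r" "conformal_radius ?R w = s"
    using conformal_radius_eqI[OF F] conformal_radius_eqI[OF E] by auto
  have FR: "F z \<in> ?R" and ER: "E z \<in> ?R" if "z \<in> ?B" for z
    using F(2) E(2) that by (auto simp: bij_betw_def)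
  define G where "G z = of_real (1 - t) * F z + of_real t * E z" for z
  have G: "G holomorphic_on ?B" unfolding G_def by (intro holomorphic_intros F E)
  have GR: "G ` ?B \<subseteq> ?R"
  proof safe
    fix z :: complex assume z: "z \<in> ?B"
    have "(1 - t) *\<^sub>R F z + t *\<^sub>R E z \<in> ?R"
      by (rule convexD [OF open_rectangle(2) FR[OF z] ER[OF z]]) (use t in auto)
    thus "G z \<in> ?R" by (simp add: G_def scaleR_conv_of_real)
  qed
  have dG: "deriv G 0 = of_real ((1 - t) * r + t * s)"
  proof -
    have "(F has_field_derivative of_real r) (at 0)" "(E has_field_derivative of_real s) (at 0)"
      using holomorphic_derivI [OF F(1) open_ball, of 0] holomorphic_derivI [OF E(1) open_ball, of 0] F(4) E(4)
      by simp_all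
    hence "(G has_field_derivative of_real (1 - t) * of_real r + of_real t * of_real s) (at 0)"
      unfolding G_def by (intro derivative_intros DERIV_cmult)
    thus ?thesis by (simp add: DERIV_imp_deriv)
  qed
  have pos: "0 < (1 - t) * r + t * s" using t F(5) E(5) by (simp add: add_pos_pos)
  have G0: "G 0 = of_real (1 - t) * v + of_real t * w" by (simp add: G_def F E)
  have "\<not> bij_betw G ?B ?R"
  proof
    assume bij: "bij_betw G ?B ?R"
    have inj: "inj_on G ?B" and img: "G ` ?B = ?R" using bij by (auto simp: bij_betw_def)
    obtain g where g: "g holomorphic_on ?R" "\<And>z. z \<in> ?B \<Longrightarrow> g (G z) = z"
      using holomorphic_has_inverse [OF G open_ball inj] img by metis
    define B where "B z = E z - F z" for z
    have B: "B holomorphic_on ?B" unfolding B_def by (intro holomorphic_intros F E)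
    define m where "m = min t (1 - t)"
    have m: "m > 0" using t by (simp add: m_def)
    \<comment> \<open>if two points on opposite sides of \<open>x\<close> lie in an interval about \<open>0\<close>, then \<open>x\<close> keeps a distance from its ends\<close>
    have aux: "\<bar>x\<bar> + m * \<bar>b\<bar> < h" if "\<bar>x - t * b\<bar> < h" "\<bar>x + (1 - t) * b\<bar> < h" for x b h :: real
    proof -
      have "m * \<bar>b\<bar> \<le> t * \<bar>b\<bar>" "m * \<bar>b\<bar> \<le> (1 - t) * \<bar>b\<bar>"
        by (auto simp: m_def intro!: mult_right_mono)
      hence "m * \<bar>b\<bar> \<le> \<bar>t * b\<bar>" "m * \<bar>b\<bar> \<le> \<bar>(1 - t) * b\<bar>"
        using t by (simp_all add: abs_mult)
      moreover have "(0 \<le> t * b \<and> 0 \<le> (1 - t) * b) \<or> (t * b \<le> 0 \<and> (1 - t) * b \<le> 0)"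
        using t by (cases "b \<ge> 0") (simp_all add: mult_nonneg_nonpos)
      ultimately show ?thesis using that by linarith
    qed
    have FG: "F z = G z - of_real t * B z" and EG: "E z = G z + of_real (1 - t) * B z" for z
      by (auto simp: G_def B_def algebra_simps)
    have bd: "\<bar>Re (G z)\<bar> + m * \<bar>Re (B z)\<bar> < k" "\<bar>Im (G z)\<bar> + m * \<bar>Im (B z)\<bar> < 1" if z: "z \<in> ?B" for z
      using FR[OF z] ER[OF z] unfolding FG EG mem_open_rectangle by (auto intro!: aux)
    have small: "\<bar>Im ((B z)\<^sup>2)\<bar> \<le> e" if e: "e > 0" and z: "z \<in> ?B" for e z
    proof -
      \<comment> \<open>chosen such that \<open>m * |Re B| < \<eta>\<close> or \<open>m * |Im B| < \<eta>\<close>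
        forces \<open>|Im (B\<^sup>2)| \<le> e\<close>, as both products are at most \<open>k + 1\<close>\<close>
      define M where "M = 2 * (k / m + 1 / m)"
      have M: "M > 0" using k m by (simp add: M_def add_pos_pos)
      define \<eta> where "\<eta> = m * e / M"
      have \<eta>: "\<eta> > 0" using m e M by (simp add: \<eta>_def)
      \<comment> \<open>the preimage of the compact set \<open>Q\<close> under \<open>G\<close> lies inside a circle of radius \<open>\<rho> < 1\<close>, which can be
        taken to enclose \<open>z\<close> as well; on this circle \<open>G\<close> avoids \<open>Q\<close>\<close>
      define Q where "Q = {p. \<bar>Re p\<bar> \<le> k - \<eta> \<and> \<bar>Im p\<bar> \<le> 1 - \<eta>}"
      have QR: "Q \<subseteq> ?R" using \<eta> by (auto simp: Q_def mem_open_rectangle)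
      have "Q = cbox (Complex (- (k - \<eta>)) (- (1 - \<eta>))) (Complex (k - \<eta>) (1 - \<eta>))"
        by (auto simp: Q_def in_cbox_complex_iff abs_le_iff)
      hence "compact Q" by simp
      hence "compact (insert z (g ` Q))"
        using g(1) QR by (intro compact_insert compact_continuous_image)
          (auto intro: holomorphic_on_imp_continuous_on continuous_on_subset)
      moreover have "insert z (g ` Q) \<subseteq> ?B"
      proof -
        have "g p \<in> ?B" if "p \<in> ?R" for p using that g(2) by (auto simp flip: img)
        thus ?thesis using z QR by auto
      qed
      moreover have "continuous_on (insert z (g ` Q)) norm" by (intro continuous_intros)
      ultimately obtain q where q: "q \<in> ?B" "\<And>y. y \<in> insert z (g ` Q) \<Longrightarrow> norm y \<le> norm q"
        using continuous_attains_sup[of "insert z (g ` Q)" norm] by blast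
      define \<rho> where "\<rho> = (norm q + 1) / 2"
      have \<rho>: "norm q < \<rho>" "\<rho> < 1" "0 < \<rho>" using q(1) by (auto simp: \<rho>_def intro: add_nonneg_pos)
      have \<rho>Q: "norm y < \<rho>" if "y \<in> insert z (g ` Q)" for y using q(2)[OF that] \<rho>(1) by simp
      have fr: "\<bar>Im ((B y)\<^sup>2)\<bar> \<le> e" if y: "y \<in> ?B" "norm y = \<rho>" for y
      proof -
        have "G y \<notin> Q" using g(2)[OF y(1)] \<rho>Q[of y] y(2) by force
        hence "m * \<bar>Re (B y)\<bar> < \<eta> \<or> m * \<bar>Im (B y)\<bar> < \<eta>"
          using bd[OF y(1)] by (auto simp: Q_def)
        moreover have "m * \<bar>Re (B y)\<bar> \<le> k + 1" "m * \<bar>Im (B y)\<bar> \<le> k + 1"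
          using bd[OF y(1)] k by linarith+
        ultimately have "(m * \<bar>Re (B y)\<bar>) * (m * \<bar>Im (B y)\<bar>) \<le> (k + 1) * \<eta>"
        proof (elim disjE)
          assume 1: "m * \<bar>Re (B y)\<bar> < \<eta>" "m * \<bar>Im (B y)\<bar> \<le> k + 1"
          show ?thesis using mult_mono[of "m * \<bar>Re (B y)\<bar>" \<eta> "m * \<bar>Im (B y)\<bar>" "k + 1"] 1 m \<eta>
            by (simp add: mult.commute)
        next
          assume 1: "m * \<bar>Im (B y)\<bar> < \<eta>" "m * \<bar>Re (B y)\<bar> \<le> k + 1"
          show ?thesis using mult_mono[of "m * \<bar>Re (B y)\<bar>" "k + 1" "m * \<bar>Im (B y)\<bar>" \<eta>] 1 m \<eta> k
            by simp
        qed
        hence "m\<^sup>2 * \<bar>Im ((B y)\<^sup>2)\<bar> \<le> 2 * ((k + 1) * \<eta>)"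
          by (simp add: abs_mult power2_eq_square algebra_simps)
        also have "2 * ((k + 1) * \<eta>) = m\<^sup>2 * e"
        proof -
          have "2 * (k + 1) = m * M" using m by (simp add: M_def field_simps)
          hence "2 * ((k + 1) * \<eta>) = m * M * \<eta>" by simp
          thus ?thesis using M by (simp add: \<eta>_def power2_eq_square)
        qed
        finally show ?thesis using m by simp
      qed
      have hol: "(\<lambda>y. c * (B y)\<^sup>2) holomorphic_on ?B" for c by (intro holomorphic_intros B)
      \<comment> \<open>the maximum principle for \<open>\<plusminus>Im (B\<^sup>2)\<close>, the real part of \<open>\<minusplus>\<i> B\<^sup>2\<close>\<close>
      have max: "Re (c * (B z)\<^sup>2) \<le> e" if c: "c = \<i> \<or> c = -\<i>" for c
      proof (rule maximum_real_frontier [of "\<lambda>y. c * (B y)\<^sup>2" "cball 0 \<rho>"])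
        have cb: "cball 0 \<rho> \<subseteq> ?B" using \<rho> by auto
        show "(\<lambda>y. c * (B y)\<^sup>2) holomorphic_on interior (cball 0 \<rho>)"
          by (rule holomorphic_on_subset [OF hol]) (use cb in auto)
        show "continuous_on (closure (cball 0 \<rho>)) (\<lambda>y. c * (B y)\<^sup>2)"
          by (rule holomorphic_on_imp_continuous_on, rule holomorphic_on_subset [OF hol]) (use cb in auto)
        show "z \<in> cball 0 \<rho>" using \<rho>Q[of z] by auto
      next
        fix y :: complex assume "y \<in> frontier (cball 0 \<rho>)"
        hence "cmod y = \<rho>" by simp
        hence "\<bar>Im ((B y)\<^sup>2)\<bar> \<le> e" using fr[of y] \<rho> by simp
        thus "Re (c * (B y)\<^sup>2) \<le> e" using c by (auto simp: abs_le_iff)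
      qed auto
      show ?thesis using max[of \<i>] max[of "-\<i>"] by (auto simp: abs_le_iff)
    qed
    have im0: "Im ((B z)\<^sup>2) = 0" if z: "z \<in> ?B" for z
      using small[OF _ z] by (metis abs_le_zero_iff dense_ge abs_ge_zero antisym)
    have "(\<lambda>z. (B z)\<^sup>2) constant_on ?B"
    proof (rule ccontr)
      assume "\<not> (\<lambda>z. (B z)\<^sup>2) constant_on ?B"
      hence "open ((\<lambda>z. (B z)\<^sup>2) ` ?B)"
        by (intro open_mapping_thm [of _ ?B]) (auto intro!: holomorphic_intros B)
      then obtain \<epsilon> where \<epsilon>: "\<epsilon> > 0" "ball ((B 0)\<^sup>2) \<epsilon> \<subseteq> (\<lambda>z. (B z)\<^sup>2) ` ?B"
        by (force simp: open_contains_ball)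
      have "(B 0)\<^sup>2 + \<i> * of_real (\<epsilon> / 2) \<in> ball ((B 0)\<^sup>2) \<epsilon>"
        using \<epsilon>(1) by (simp add: dist_norm norm_mult)
      then obtain z where z: "z \<in> ?B" "(B 0)\<^sup>2 + \<i> * of_real (\<epsilon> / 2) = (B z)\<^sup>2" using \<epsilon>(2) by blast
      have "Im ((B 0)\<^sup>2 + \<i> * of_real (\<epsilon> / 2)) = 0" unfolding z(2) by (rule im0[OF z(1)])
      thus False using im0[of 0] \<epsilon>(1) by simp
    qed
    then obtain b where b: "\<And>z. z \<in> ?B \<Longrightarrow> (B z)\<^sup>2 = b" unfolding constant_on_def by blast
    have "B constant_on ?B"
    proof (rule maximum_modulus_principle [OF B open_ball _ open_ball order_refl])
      show "cmod (B z) \<le> cmod (B 0)" if "z \<in> ?B" for z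
      proof -
        have "(cmod (B z))\<^sup>2 = (cmod (B 0))\<^sup>2"
          using b[OF that] b[of 0] by (simp flip: norm_power)
        thus ?thesis by simp
      qed
    qed auto
    then obtain d where "\<And>z. z \<in> ?B \<Longrightarrow> B z = d" unfolding constant_on_def by blast
    hence EF: "E z = F z + (w - v)" if "z \<in> ?B" for z
      using that F(3) E(3) by (metis B_def add.commute centre_in_ball diff_add_cancel zero_less_one)
    have shift: "p + (w - v) \<in> ?R" if p: "p \<in> ?R" for p
    proof -
      have "p \<in> F ` ?B" using F(2) p by (simp add: bij_betw_def)
      then obtain z where "z \<in> ?B" "F z = p" by blast
      thus ?thesis using EF[of z] ER[of z] by simp
    qed
    have shifts: "v + of_nat n * (w - v) \<in> ?R" for n
    proof (induction n)
      case (Suc n)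
      have "v + of_nat (Suc n) * (w - v) = (v + of_nat n * (w - v)) + (w - v)"
        by (simp add: algebra_simps)
      thus ?case using shift[OF Suc] by metis
    qed (use v in simp)
    obtain M where M: "\<And>p. p \<in> ?R \<Longrightarrow> dist v p \<le> M"
      using open_rectangle(3) by (metis bounded_any_center)
    obtain n where n: "M < of_nat n * cmod (w - v)"
      using reals_Archimedean3[of "cmod (w - v)"] vw by auto
    show False using M[OF shifts[of n]] n by (simp add: dist_norm norm_mult)
  qed
  hence "cmod (deriv G 0) < conformal_radius ?R (G 0)"
    using GR by (intro conformal_radius_ge(2) open_rectangle G) (auto simp: image_subset_iff)
  thus ?thesis using pos unfolding dG rs G0 norm_of_real by simp
qed

text \<open>The conformal radius is a strictly concave and even function of the real part.\<close>

lemma conformal_radius_rectangle_mono_Re: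
  assumes "Complex x' y \<in> open_rectangle k" "\<bar>x\<bar> < \<bar>x'\<bar>"
  shows "conformal_radius (open_rectangle k) (Complex x' y) < conformal_radius (open_rectangle k) (Complex x y)"
proof -
  let ?r = "conformal_radius (open_rectangle k)" and ?a = "\<bar>x'\<bar>"
  define t where "t = (x + ?a) / (2 * ?a)"
  have t: "0 < t" "t < 1" using assms(2) by (auto simp: t_def field_simps)
  have m: "Complex (-?a) y \<in> open_rectangle k" "Complex ?a y \<in> open_rectangle k"
    using assms(1) by (auto simp: mem_open_rectangle)
  have "?r (Complex \<bar>?a\<bar> \<bar>y\<bar>) = ?r (Complex x' y)"
    using conformal_radius_rectangle_abs[OF assms(1)] by simp
  hence r: "?r (Complex (-?a) y) = ?r (Complex x' y)" "?r (Complex ?a y) = ?r (Complex x' y)"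
    using conformal_radius_rectangle_abs[OF m(1)] conformal_radius_rectangle_abs[OF m(2)] by simp_all
  have "of_real (1 - t) * Complex (-?a) y + of_real t * Complex ?a y = Complex x y"
    using assms(2) by (simp add: t_def complex_eq_iff field_simps)
  hence "(1 - t) * ?r (Complex x' y) + t * ?r (Complex x' y) < ?r (Complex x y)"
    using conformal_radius_rectangle_strict_concave[OF m _ t] assms(2) by (simp add: r)
  thus ?thesis by (simp add: algebra_simps)
qed

lemma conformal_radius_rectangle_mono_Im:
  assumes "Complex x y' \<in> open_rectangle k" "\<bar>y\<bar> < \<bar>y'\<bar>"
  shows "conformal_radius (open_rectangle k) (Complex x y') < conformal_radius (open_rectangle k) (Complex x y)"
proof -
  let ?r = "conformal_radius (open_rectangle k)" and ?a = "\<bar>y'\<bar>"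
  define t where "t = (y + ?a) / (2 * ?a)"
  have t: "0 < t" "t < 1" using assms(2) by (auto simp: t_def field_simps)
  have m: "Complex x (-?a) \<in> open_rectangle k" "Complex x ?a \<in> open_rectangle k"
    using assms(1) by (auto simp: mem_open_rectangle)
  have "?r (Complex \<bar>x\<bar> \<bar>?a\<bar>) = ?r (Complex x y')"
    using conformal_radius_rectangle_abs[OF assms(1)] by simp
  hence r: "?r (Complex x (-?a)) = ?r (Complex x y')" "?r (Complex x ?a) = ?r (Complex x y')"
    using conformal_radius_rectangle_abs[OF m(1)] conformal_radius_rectangle_abs[OF m(2)] by simp_all
  have "of_real (1 - t) * Complex x (-?a) + of_real t * Complex x ?a = Complex x y"
    using assms(2) by (simp add: t_def complex_eq_iff field_simps)
  hence "(1 - t) * ?r (Complex x y') + t * ?r (Complex x y') < ?r (Complex x y)"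
    using conformal_radius_rectangle_strict_concave[OF m _ t] assms(2) by (simp add: r)
  thus ?thesis by (simp add: algebra_simps)
qed

text \<open>The rectangle shrunk by the factor \<open>m\<close> towards its corner \<open>k + \<i>\<close> is a proper part of it. Its conformal radius at the
  image of \<open>k - 1\<close> is \<open>m\<close> times that of the rectangle at \<open>k - 1\<close>.\<close>

lemma conformal_radius_rectangle_bisector:
  assumes k: "k \<ge> 1" and m: "0 < m" "m < 1"
  shows "m * conformal_radius (open_rectangle k) (of_real (k - 1))
    < conformal_radius (open_rectangle k) (Complex (k - m) (1 - m))"
proof -
  let ?R = "open_rectangle k" and ?B = "ball (0::complex) 1"
  have in1: "of_real (k - 1) \<in> ?R" using k by (auto simp: mem_open_rectangle)
  obtain F r where F: "F holomorphic_on ?B" "bij_betw F ?B ?R" "F 0 = of_real (k - 1)"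
    "deriv F 0 = complex_of_real r" "0 < r"
    using riemann_map_normalized [OF open_rectangle(1,4,5) in1] by blast
  have FR: "F z \<in> ?R" if "z \<in> ?B" for z using F(2) that by (auto simp: bij_betw_def)
  define c where "c = Complex k 1"
  define G where "G z = c + of_real m * (F z - c)" for z
  have ReG: "Re (G z) = k - m * (k - Re (F z))" and ImG: "Im (G z) = 1 - m * (1 - Im (F z))" for z
    by (auto simp: G_def c_def algebra_simps)
  have G: "G holomorphic_on ?B" unfolding G_def by (intro holomorphic_intros F)
  have GR: "G ` ?B \<subseteq> ?R"
  proof safe
    fix z :: complex assume z: "z \<in> ?B"
    have *: "0 < m * x \<and> m * x < 2 * b" if "0 < x" "x < 2 * b" for x b
    proof -
      have "m * x < 1 * x" using m that by (intro mult_strict_right_mono) auto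
      moreover have "0 < m * x" using m that by simp
      ultimately show ?thesis using that by linarith
    qed
    have "0 < m * (k - Re (F z)) \<and> m * (k - Re (F z)) < 2 * k"
         "0 < m * (1 - Im (F z)) \<and> m * (1 - Im (F z)) < 2 * 1"
      using FR[OF z] *[of "k - Re (F z)" k] *[of "1 - Im (F z)" 1]
      by (auto simp: mem_open_rectangle abs_less_iff)
    thus "G z \<in> ?R" by (simp add: mem_open_rectangle abs_less_iff ReG ImG)
  qed
  have dG: "deriv G 0 = of_real (m * r)"
  proof -
    have "(F has_field_derivative of_real r) (at 0)"
      using holomorphic_derivI [OF F(1) open_ball, of 0] F(4) by simp
    hence "(G has_field_derivative of_real (m * r)) (at 0)"
      unfolding G_def by (auto intro!: derivative_eq_intros)
    thus ?thesis by (simp add: DERIV_imp_deriv)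
  qed
  have G0: "G 0 = Complex (k - m) (1 - m)"
    by (simp add: complex_eq_iff ReG ImG F(3) algebra_simps)
  have "\<not> bij_betw G ?B ?R"
  proof
    assume bij: "bij_betw G ?B ?R"
    \<comment> \<open>a point of the rectangle to the left of the shrunk one\<close>
    define p where "p = Complex (k - 2 * k * ((1 + m) / 2)) 0"
    have "p \<in> ?R" using k m by (simp add: p_def mem_open_rectangle abs_less_iff algebra_simps)
    hence "p \<in> G ` ?B" using bij by (simp add: bij_betw_def)
    then obtain z where z: "z \<in> ?B" "G z = p" by blast
    have "m * (k - Re (F z)) = k * (1 + m)"
      using ReG[of z] z(2) by (simp add: p_def)
    moreover have "m * (k - Re (F z)) \<le> m * (2 * k)"
      using FR[OF z(1)] m by (intro mult_left_mono) (auto simp: mem_open_rectangle)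
    moreover have "k * (1 - m) > 0" using k m by simp
    ultimately show False by (simp add: algebra_simps)
  qed
  hence "cmod (deriv G 0) < conformal_radius ?R (G 0)"
    using GR m k G0
    by (intro conformal_radius_ge(2) open_rectangle G) (auto simp: mem_open_rectangle abs_less_iff)
  moreover have "conformal_radius ?R (of_real (k - 1)) = r" by (rule conformal_radius_eqI [OF F])
  moreover have "cmod (deriv G 0) = m * r"
    using m F(5) unfolding dG norm_of_real by simp
  ultimately show ?thesis using G0 by simp
qed

text \<open>Among the points at distance \<open>m\<close> from the boundary, the conformal radius is smallest on the bisectors of the angles at the
  corners; on those, the quotient is largest for \<open>m = 1\<close>.\<close>

lemma rectangle_ratio:
  fixes k :: real
  assumes k: "k \<ge> 1" and v: "v \<in> open_rectangle k"
  defines "r \<equiv> conformal_radius (open_rectangle k)"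
  shows "2 * boundary_dist (open_rectangle k) v / r v \<le> 2 / r (of_real (k - 1))"
    and "2 * boundary_dist (open_rectangle k) v / r v = 2 / r (of_real (k - 1)) \<longleftrightarrow>
      v = complex_of_real (k - 1) \<or> v = - complex_of_real (k - 1)"
proof -
  let ?R = "open_rectangle k"
  define x y m where "x = \<bar>Re v\<bar>" and "y = \<bar>Im v\<bar>" and "m = min (k - x) (1 - y)"
  have xy: "0 \<le> x" "x \<le> k - m" "0 \<le> y" "y \<le> 1 - m" "0 < m" "m \<le> 1"
    using v by (auto simp: x_def y_def m_def mem_open_rectangle)
  have d: "boundary_dist ?R v = m" using boundary_dist_rectangle[OF v] by (simp add: m_def x_def y_def)
  have rpos: "r w > 0" if "w \<in> ?R" for w
    unfolding r_def by (rule conformal_radius_pos) (use open_rectangle that in auto)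
  have in1: "of_real (k - 1) \<in> ?R" using k by (auto simp: mem_open_rectangle)
  have rv: "r v = r (Complex x y)"
    using conformal_radius_rectangle_abs[of "Re v" "Im v" k] v by (simp add: r_def x_def y_def)
  have in2: "Complex (k - m) y \<in> ?R" "Complex (k - m) (1 - m) \<in> ?R"
    using xy k by (auto simp: mem_open_rectangle)
  have 1: "r (Complex (k - m) y) \<le> r (Complex x y)" "x < k - m \<Longrightarrow> r (Complex (k - m) y) < r (Complex x y)"
    using conformal_radius_rectangle_mono_Re[OF in2(1), of x] xy k by (cases "x = k - m"; simp add: r_def)+
  have 2: "r (Complex (k - m) (1 - m)) \<le> r (Complex (k - m) y)"
    "y < 1 - m \<Longrightarrow> r (Complex (k - m) (1 - m)) < r (Complex (k - m) y)"
    using conformal_radius_rectangle_mono_Im[OF in2(2), of y] xy k by (cases "y = 1 - m"; simp add: r_def)+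
  have 3: "m * r (of_real (k - 1)) \<le> r (Complex (k - m) (1 - m))"
    "m < 1 \<Longrightarrow> m * r (of_real (k - 1)) < r (Complex (k - m) (1 - m))"
    using conformal_radius_rectangle_bisector[OF k xy(5)] xy
    by (cases "m = 1"; simp add: r_def complex_of_real_def)+
  have le: "m * r (of_real (k - 1)) \<le> r v" using 1 2 3 rv by linarith
  have eq: "m * r (of_real (k - 1)) = r v \<longleftrightarrow> m = 1 \<and> x = k - 1 \<and> y = 0"
  proof
    assume "m * r (of_real (k - 1)) = r v"
    hence "\<not> m < 1" "\<not> x < k - m" "\<not> y < 1 - m" using 1 2 3 rv by linarith+
    thus "m = 1 \<and> x = k - 1 \<and> y = 0" using xy by linarith
  next
    assume "m = 1 \<and> x = k - 1 \<and> y = 0"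
    thus "m * r (of_real (k - 1)) = r v" by (simp add: rv complex_of_real_def)
  qed
  show "2 * boundary_dist ?R v / r v \<le> 2 / r (of_real (k - 1))"
    using le rpos[OF v] rpos[OF in1] by (simp add: d field_simps)
  have "2 * boundary_dist ?R v / r v = 2 / r (of_real (k - 1)) \<longleftrightarrow> m * r (of_real (k - 1)) = r v"
    using rpos[OF v] rpos[OF in1] by (simp add: d field_simps)
  also have "\<dots> \<longleftrightarrow> x = k - 1 \<and> y = 0"
    unfolding eq by (auto simp: m_def)
  also have "\<dots> \<longleftrightarrow> v = complex_of_real (k - 1) \<or> v = - complex_of_real (k - 1)"
    using k by (auto simp: x_def y_def complex_eq_iff abs_if split: if_splits)
  finally show "2 * boundary_dist ?R v / r v = 2 / r (of_real (k - 1)) \<longleftrightarrow>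
      v = complex_of_real (k - 1) \<or> v = - complex_of_real (k - 1)" .
qed

section \<open>Elliptic integrals and Jacobi functions on the real line\<close>

lemma elliptic_radicand_pos:
  fixes l :: real
  assumes "0 \<le> l" "l < 1"
  shows "0 < 1 - l\<^sup>2 * (sin x)\<^sup>2"
proof -
  have "l\<^sup>2 * (sin x)\<^sup>2 \<le> l\<^sup>2 * 1"
    by (intro mult_left_mono) (auto simp: abs_square_le_1)
  also have "l\<^sup>2 < 1" using assms by (simp add: abs_square_less_1)
  finally show ?thesis by simp
qed

context
  fixes l :: real
  assumes l: "0 \<le> l" "l < 1"
begin

lemma elliptic_F_deriv:
  "(elliptic_F l has_real_derivative 1 / sqrt (1 - l\<^sup>2 * (sin x)\<^sup>2)) (at x)"
proof -
  let ?f = "\<lambda>x. 1 / sqrt (1 - l\<^sup>2 * (sin x)\<^sup>2)"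
  define a where "a = \<bar>x\<bar> + 1"
  have ne: "sqrt (1 - l\<^sup>2 * (sin y)\<^sup>2) \<noteq> 0" for y using elliptic_radicand_pos[OF l, of y] by simp
  have "continuous_on {-a..a} ?f"
    by (intro continuous_intros) (use ne in auto)
  hence "((\<lambda>u. LBINT y=0..u. ?f y) has_vector_derivative ?f x) (at x within {-a..a})"
    using interval_integral_FTC2[of "-a" 0 a ?f x] by (simp add: a_def zero_ereal_def)
  moreover have "at x within {-a..a} = at x"
    by (rule at_within_interior) (auto simp: a_def interior_atLeastAtMost_real)
  ultimately show ?thesis
    by (simp add: has_real_derivative_iff_has_vector_derivative elliptic_F_def [abs_def])
qed

lemma elliptic_F_0 [simp]: "elliptic_F l 0 = 0"
  by (simp add: elliptic_F_def zero_ereal_def)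

lemma elliptic_F_cont: "continuous_on A (elliptic_F l)"
  using elliptic_F_deriv by (intro continuous_at_imp_continuous_on ballI DERIV_isCont) blast

lemma elliptic_F_strict_mono: "x < y \<Longrightarrow> elliptic_F l x < elliptic_F l y"
proof (rule DERIV_pos_imp_increasing [where f = "elliptic_F l"])
  fix z
  show "\<exists>d. (elliptic_F l has_real_derivative d) (at z) \<and> 0 < d"
    using elliptic_F_deriv[of z] elliptic_radicand_pos[OF l, of z]
    by (intro exI[of _ "1 / sqrt (1 - l\<^sup>2 * (sin z)\<^sup>2)"]) simp
qed

lemma elliptic_F_minus: "elliptic_F l (- x) = - elliptic_F l x"
proof -
  have "((\<lambda>x. elliptic_F l x + elliptic_F l (- x)) has_real_derivative 0) (at x)" for x
    by (auto intro!: derivative_eq_intros DERIV_chain'[OF _ elliptic_F_deriv] elliptic_F_deriv)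
  hence "elliptic_F l x + elliptic_F l (- x) = elliptic_F l 0 + elliptic_F l (- 0)"
    by (intro DERIV_isconst_all) blast
  thus ?thesis by simp
qed

lemma elliptic_F_ge: "0 \<le> x \<Longrightarrow> x \<le> elliptic_F l x"
proof -
  assume x: "0 \<le> x"
  have "elliptic_F l 0 - 0 \<le> elliptic_F l x - x"
  proof (rule DERIV_nonneg_imp_nondecreasing [OF x])
    fix y
    have "sqrt (1 - l\<^sup>2 * (sin y)\<^sup>2) \<le> 1" by simp
    hence "0 \<le> 1 / sqrt (1 - l\<^sup>2 * (sin y)\<^sup>2) - 1"
      using elliptic_radicand_pos[OF l, of y] by (simp add: field_simps)
    thus "\<exists>z. ((\<lambda>x. elliptic_F l x - x) has_real_derivative z) (at y) \<and> 0 \<le> z"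
      by (intro exI[of _ "1 / sqrt (1 - l\<^sup>2 * (sin y)\<^sup>2) - 1"])
         (auto intro!: derivative_eq_intros elliptic_F_deriv)
  qed
  thus "x \<le> elliptic_F l x" by simp
qed

lemma bij_elliptic_F: "bij (elliptic_F l)"
proof (rule bijI)
  show "inj (elliptic_F l)"
    using elliptic_F_strict_mono by (metis injI linorder_neqE_linordered_idom order_less_irrefl)
  have "\<exists>x. elliptic_F l x = y" for y
  proof -
    have "elliptic_F l (- \<bar>y\<bar>) \<le> y" "y \<le> elliptic_F l \<bar>y\<bar>"
      using elliptic_F_ge[of "\<bar>y\<bar>"] by (auto simp: elliptic_F_minus)
    thus ?thesis
      using IVT'[of "elliptic_F l" "- \<bar>y\<bar>" y "\<bar>y\<bar>"] elliptic_F_cont by auto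
  qed
  thus "surj (elliptic_F l)" by (metis surjI)
qed

lemma jacobi_am_F [simp]: "jacobi_am l (elliptic_F l x) = x"
  and elliptic_F_am [simp]: "elliptic_F l (jacobi_am l x) = x"
  using bij_elliptic_F by (simp_all add: jacobi_am_def bij_def surj_f_inv_f)

lemma jacobi_am_less_iff: "jacobi_am l x < jacobi_am l y \<longleftrightarrow> x < y"
  using elliptic_F_strict_mono by (metis elliptic_F_am linorder_neqE_linordered_idom order_less_asym)

lemma jacobi_am_deriv:
  "(jacobi_am l has_real_derivative sqrt (1 - l\<^sup>2 * (sin (jacobi_am l x))\<^sup>2)) (at x)"
proof -
  have "(jacobi_am l has_real_derivative inverse (1 / sqrt (1 - l\<^sup>2 * (sin (jacobi_am l x))\<^sup>2)))
          (at (elliptic_F l (jacobi_am l x)))"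
    by (rule has_field_derivative_inverse_strong [where S = UNIV and f = "elliptic_F l"])
       (use elliptic_F_deriv elliptic_radicand_pos[OF l, of "jacobi_am l x"] elliptic_F_cont in auto)
  thus ?thesis by simp
qed

lemma jacobi_am_quarter_period: "jacobi_am l (elliptic_F l (pi / 2)) = pi / 2"
    "jacobi_am l (- elliptic_F l (pi / 2)) = - (pi / 2)" "jacobi_am l 0 = 0"
  using jacobi_am_F[of "- (pi / 2)"] jacobi_am_F[of 0] by (simp_all add: elliptic_F_minus)

text \<open>The substitution \<open>t = sin \<theta>\<close>. The integral that defines \<open>K\<close> is improper at \<open>1\<close>.\<close>

lemma elliptic_K_eq_F: "elliptic_K l = elliptic_F l (pi / 2)"
proof -
  let ?f = "\<lambda>t. 1 / sqrt ((1 - t\<^sup>2) * (1 - l\<^sup>2 * t\<^sup>2))"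
  let ?G = "\<lambda>t. elliptic_F l (arcsin t)"
  have pos: "0 < 1 - t\<^sup>2" "0 < 1 - l\<^sup>2 * t\<^sup>2" if "0 < t" "t < 1" for t :: real
    using that elliptic_radicand_pos[OF l, of "arcsin t"] by (auto simp: abs_square_less_1)
  have cont: "continuous_on {0..1} ?G"
    by (rule continuous_on_compose2 [OF elliptic_F_cont[of UNIV]]) (auto intro!: continuous_intros)
  have "(LBINT t=ereal 0..ereal 1. ?f t) = elliptic_F l (pi / 2) - elliptic_F l 0"
  proof (rule interval_integral_FTC_nonneg(2) [where F = ?G])
    show "DERIV ?G t :> ?f t" if "ereal 0 < ereal t" "ereal t < ereal 1" for t
    proof -
      have t: "0 < t" "t < 1" using that by auto
      have "(?G has_real_derivative 1 / sqrt (1 - l\<^sup>2 * (sin (arcsin t))\<^sup>2) * inverse (sqrt (1 - t\<^sup>2))) (at t)"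
        by (rule DERIV_chain2 [OF elliptic_F_deriv DERIV_arcsin]) (use t in auto)
      thus ?thesis using t by (simp add: real_sqrt_mult divide_inverse mult.commute)
    qed
    show "isCont ?f t" if "ereal 0 < ereal t" "ereal t < ereal 1" for t
      using pos[of t] that by (intro continuous_intros) auto
    show "AE t in lborel. ereal 0 < ereal t \<longrightarrow> ereal t < ereal 1 \<longrightarrow> 0 \<le> ?f t"
      using pos by (intro AE_I2) (auto intro!: divide_nonneg_nonneg simp: less_imp_le)
    have "((\<lambda>t. ?G t) \<longlongrightarrow> ?G 0) (at_right 0)" "((\<lambda>t. ?G t) \<longlongrightarrow> ?G 1) (at_left 1)"
      using continuous_on_Icc_at_rightD[OF cont] continuous_on_Icc_at_leftD[OF cont] by simp_all
    thus "((?G \<circ> real_of_ereal) \<longlongrightarrow> elliptic_F l 0) (at_right (ereal 0))"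
      "((?G \<circ> real_of_ereal) \<longlongrightarrow> elliptic_F l (pi / 2)) (at_left (ereal 1))"
      by (simp_all add: ereal_tendsto_simps)
  qed simp
  thus ?thesis by (simp add: elliptic_K_def zero_ereal_def one_ereal_def)
qed

lemma elliptic_K_pos: "0 < elliptic_K l"
  using elliptic_F_strict_mono[of 0 "pi / 2"] by (simp add: elliptic_K_eq_F)

end

text \<open>The Jacobi functions \<open>sn\<close>, \<open>cn\<close>, \<open>dn\<close> of modulus \<open>l\<close> as functions of a real variable. The formula for \<open>dn\<close>
  gives the derivative of the amplitude.\<close>

definition re_sn :: "real \<Rightarrow> real \<Rightarrow> real" where "re_sn l x = sin (jacobi_am l x)"
definition re_cn :: "real \<Rightarrow> real \<Rightarrow> real" where "re_cn l x = cos (jacobi_am l x)"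
definition re_dn :: "real \<Rightarrow> real \<Rightarrow> real" where "re_dn l x = sqrt (1 - l\<^sup>2 * (re_sn l x)\<^sup>2)"

lemma re_cn_squared: "(re_cn l x)\<^sup>2 = 1 - (re_sn l x)\<^sup>2"
  by (simp add: re_sn_def re_cn_def cos_squared_eq)

context
  fixes l :: real
  assumes l: "0 \<le> l" "l < 1"
begin

lemma re_dn_squared: "(re_dn l x)\<^sup>2 = 1 - l\<^sup>2 * (re_sn l x)\<^sup>2"
  and re_dn_pos: "0 < re_dn l x"
  using elliptic_radicand_pos[OF l, of "jacobi_am l x"] by (simp_all add: re_dn_def re_sn_def)

lemma re_sn_deriv: "(re_sn l has_real_derivative re_cn l x * re_dn l x) (at x)"
  and re_cn_deriv: "(re_cn l has_real_derivative - re_sn l x * re_dn l x) (at x)"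
  and re_dn_deriv: "(re_dn l has_real_derivative - l\<^sup>2 * re_sn l x * re_cn l x) (at x)"
proof -
  have am: "(jacobi_am l has_real_derivative re_dn l x) (at x)"
    using jacobi_am_deriv[OF l] by (simp add: re_dn_def re_sn_def)
  show sn: "(re_sn l has_real_derivative re_cn l x * re_dn l x) (at x)"
    unfolding re_sn_def [abs_def] re_cn_def by (rule DERIV_chain2 [OF DERIV_sin am])
  show "(re_cn l has_real_derivative - re_sn l x * re_dn l x) (at x)"
    unfolding re_sn_def re_cn_def [abs_def] by (rule DERIV_chain2 [OF DERIV_cos am])
  have "((\<lambda>x. sqrt (1 - l\<^sup>2 * (re_sn l x)\<^sup>2)) has_real_derivative
      (inverse (sqrt (1 - l\<^sup>2 * (re_sn l x)\<^sup>2)) / 2) * (- (l\<^sup>2 * (2 * re_sn l x * (re_cn l x * re_dn l x))))) (at x)"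
  proof (rule DERIV_chain2 [OF DERIV_real_sqrt])
    show "0 < 1 - l\<^sup>2 * (re_sn l x)\<^sup>2"
      using elliptic_radicand_pos[OF l, of "jacobi_am l x"] by (simp add: re_sn_def)
    show "((\<lambda>x. 1 - l\<^sup>2 * (re_sn l x)\<^sup>2) has_real_derivative - (l\<^sup>2 * (2 * re_sn l x * (re_cn l x * re_dn l x)))) (at x)"
      by (auto intro!: derivative_eq_intros sn)
  qed
  thus "(re_dn l has_real_derivative - l\<^sup>2 * re_sn l x * re_cn l x) (at x)"
    using re_dn_pos[of x] by (simp add: re_dn_def [symmetric] re_dn_def [abs_def, symmetric] field_simps)
qed

lemma re_jacobi_0 [simp]: "re_sn l 0 = 0" "re_cn l 0 = 1" "re_dn l 0 = 1"
  by (simp_all add: re_sn_def re_cn_def re_dn_def jacobi_am_quarter_period[OF l])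

lemma re_cn_quarter_period: "re_cn l (elliptic_K l) = 0" "re_cn l (- elliptic_K l) = 0"
  by (simp_all add: re_cn_def elliptic_K_eq_F[OF l] jacobi_am_quarter_period[OF l])

lemma re_cn_pos: "\<bar>x\<bar> < elliptic_K l \<Longrightarrow> 0 < re_cn l x"
  using jacobi_am_less_iff[OF l, of "- elliptic_K l" x] jacobi_am_less_iff[OF l, of x "elliptic_K l"]
  by (auto simp: re_cn_def elliptic_K_eq_F[OF l] jacobi_am_quarter_period[OF l] abs_less_iff intro!: cos_gt_zero_pi)

lemma re_sn_pos: "0 < x \<Longrightarrow> x \<le> elliptic_K l \<Longrightarrow> 0 < re_sn l x"
  using jacobi_am_less_iff[OF l, of 0 x] jacobi_am_less_iff[OF l, of "elliptic_K l" x]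
  by (auto simp: re_sn_def elliptic_K_eq_F[OF l] jacobi_am_quarter_period[OF l] not_less intro!: sin_gt_zero)

end

section \<open>The modulus\<close>

lemma elliptic_K_strict_mono:
  assumes l: "0 \<le> l" "l < l'" "l' < 1"
  shows "elliptic_K l < elliptic_K l'"
proof -
  have l1: "l < 1" and l2: "0 \<le> l'" using l by auto
  let ?d = "\<lambda>x. elliptic_F l' x - elliptic_F l x"
  have "?d 0 < ?d (pi / 2)"
  proof (rule DERIV_pos_imp_increasing_open [where f = ?d])
    fix x :: real assume x: "0 < x" "x < pi / 2"
    have "l\<^sup>2 < l'\<^sup>2" using l by (simp add: power2_strict_mono)
    moreover have "0 < (sin x)\<^sup>2" using x sin_gt_zero[of x] by simp
    ultimately have "1 - l'\<^sup>2 * (sin x)\<^sup>2 < 1 - l\<^sup>2 * (sin x)\<^sup>2" by simp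
    hence "0 < 1 / sqrt (1 - l'\<^sup>2 * (sin x)\<^sup>2) - 1 / sqrt (1 - l\<^sup>2 * (sin x)\<^sup>2)"
      using elliptic_radicand_pos[OF l2 l(3), of x] by (simp add: divide_strict_left_mono)
    thus "\<exists>y. (?d has_real_derivative y) (at x) \<and> 0 < y"
      using elliptic_F_deriv[OF l(1) l1, of x] elliptic_F_deriv[OF l2 l(3), of x] by (blast intro: DERIV_diff)
  next
    show "continuous_on {0..pi / 2} ?d"
      by (intro continuous_intros elliptic_F_cont l l1 l2)
  qed simp
  thus ?thesis using l l1 l2 by (simp add: elliptic_K_eq_F)
qed

text \<open>With \<open>c = sqrt (1 - l\<^sup>2)\<close> the integrand \<open>1 / sqrt (cos\<^sup>2 x + c\<^sup>2 sin\<^sup>2 x)\<close> is at least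
  \<open>1 / (pi / 2 - x + c)\<close>. So \<open>K(l)\<close> tends to infinity as \<open>l\<close> tends to \<open>1\<close>.\<close>

lemma elliptic_K_ge_ln:
  assumes l: "0 \<le> l" "l < 1"
  shows "ln (1 + pi / (2 * sqrt (1 - l\<^sup>2))) \<le> elliptic_K l"
proof -
  define c where "c = sqrt (1 - l\<^sup>2)"
  have l2: "l\<^sup>2 < 1" using l by (simp add: abs_square_less_1)
  hence c: "0 < c" "c\<^sup>2 = 1 - l\<^sup>2" by (simp_all add: c_def)
  let ?d = "\<lambda>x. elliptic_F l x + ln (pi / 2 - x + c)"
  have "?d 0 \<le> ?d (pi / 2)"
  proof (rule DERIV_nonneg_imp_nondecreasing [where f = ?d])
    fix x :: real assume x: "0 \<le> x" "x \<le> pi / 2"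
    have p: "0 < pi / 2 - x + c" using x c by simp
    have "0 \<le> cos x" "0 \<le> sin x" "sin x \<le> 1" using x by (auto intro!: cos_ge_zero sin_ge_zero)
    moreover have "cos x \<le> pi / 2 - x"
      using sin_x_le_x[of "pi / 2 - x"] x by (simp add: sin_diff)
    moreover have "1 - l\<^sup>2 * (sin x)\<^sup>2 = (cos x)\<^sup>2 + (c * sin x)\<^sup>2"
      by (simp add: power_mult_distrib c(2) cos_squared_eq algebra_simps)
    moreover have "c * sin x \<le> c" "0 \<le> c * sin x" using calculation c(1) by (auto simp: mult_left_le)
    ultimately have "1 - l\<^sup>2 * (sin x)\<^sup>2 \<le> (pi / 2 - x)\<^sup>2 + c\<^sup>2"
      by (simp add: add_mono power_mono)
    also have "\<dots> \<le> (pi / 2 - x + c)\<^sup>2"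
      using x c(1) by (simp add: power2_sum)
    finally have "sqrt (1 - l\<^sup>2 * (sin x)\<^sup>2) \<le> pi / 2 - x + c"
      using p by (simp add: real_le_lsqrt)
    hence "0 \<le> 1 / sqrt (1 - l\<^sup>2 * (sin x)\<^sup>2) + (- 1) / (pi / 2 - x + c)"
      using elliptic_radicand_pos[OF l, of x] p by (simp add: frac_le)
    moreover have "(?d has_real_derivative 1 / sqrt (1 - l\<^sup>2 * (sin x)\<^sup>2) + (- 1) / (pi / 2 - x + c)) (at x)"
      using p by (auto intro!: derivative_eq_intros elliptic_F_deriv l)
    ultimately show "\<exists>y. (?d has_real_derivative y) (at x) \<and> 0 \<le> y" by blast
  qed simp
  hence "ln (pi / 2 + c) - ln c \<le> elliptic_K l" using l by (simp add: elliptic_K_eq_F)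
  moreover have "ln (pi / 2 + c) - ln c = ln (1 + pi / (2 * c))"
  proof -
    have "pi / 2 + c = c * (1 + pi / (2 * c))" using c(1) by (simp add: field_simps)
    moreover have "0 < 1 + pi / (2 * c)" using c(1) by (simp add: add_pos_pos)
    ultimately show ?thesis using c(1) by (simp add: ln_mult)
  qed
  ultimately show ?thesis by (simp add: c_def)
qed

lemma elliptic_K_continuous_on: "continuous_on {0..<1} elliptic_K"
proof -
  let ?f = "\<lambda>l x. 1 / sqrt (1 - l\<^sup>2 * (sin x)\<^sup>2) :: real"
  have "continuous_on {0..<1} (\<lambda>l. integral (cbox 0 (pi / 2)) (?f l))"
  proof (rule integral_continuous_on_param)
    have "sqrt (1 - (fst p)\<^sup>2 * (sin (snd p))\<^sup>2) \<noteq> 0" if "p \<in> {0..<1} \<times> cbox 0 (pi / 2)" for p :: "real \<times> real"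
      using elliptic_radicand_pos[of "fst p" "snd p"] that by auto
    thus "continuous_on ({0..<1} \<times> cbox 0 (pi / 2)) (\<lambda>(l, x). ?f l x)"
      unfolding split_beta by (intro continuous_intros) blast
  qed
  moreover have "integral (cbox 0 (pi / 2)) (?f l) = elliptic_K l" if "l \<in> {0..<1}" for l
  proof -
    have l: "0 \<le> l" "l < 1" using that by auto
    have "(?f l has_integral (elliptic_F l (pi / 2) - elliptic_F l 0)) {0..pi / 2}"
      using elliptic_F_deriv[OF l]
      by (intro fundamental_theorem_of_calculus)
         (auto simp flip: has_real_derivative_iff_has_vector_derivative intro: has_field_derivative_at_within)
    thus ?thesis using l by (simp add: integral_unique elliptic_K_eq_F)
  qed
  ultimately show ?thesis by (rule continuous_on_eq)
qed

lemma complementary_modulus: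
  fixes l :: real
  assumes "0 < l" "l < 1"
  shows "0 < sqrt (1 - l\<^sup>2)" "sqrt (1 - l\<^sup>2) < 1" "sqrt (1 - (sqrt (1 - l\<^sup>2))\<^sup>2) = l"
proof -
  have "0 < l\<^sup>2" "l\<^sup>2 < 1" using assms by (auto simp: abs_square_less_1)
  thus "0 < sqrt (1 - l\<^sup>2)" "sqrt (1 - l\<^sup>2) < 1" "sqrt (1 - (sqrt (1 - l\<^sup>2))\<^sup>2) = l"
    using assms by simp_all
qed

text \<open>The quotient \<open>K / K'\<close> is continuous and strictly increasing. It is \<open>1\<close> at \<open>l = sqrt (1 / 2)\<close>, and near \<open>0\<close>
  it is small by the logarithmic lower bound for \<open>K'\<close>.\<close>

theorem elliptic_modulus_ex1:
  assumes q: "0 < q" "q \<le> 1"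
  shows "\<exists>!l. 0 < l \<and> l < 1 \<and> elliptic_K l / elliptic_K' l = q"
proof -
  let ?f = "\<lambda>l. elliptic_K l / elliptic_K' l"
  have K'pos: "0 < elliptic_K' l" if "0 < l" "l < 1" for l
    using elliptic_K_pos complementary_modulus[OF that] by (simp add: elliptic_K'_def)
  have mono: "?f a < ?f b" if "0 < a" "a < b" "b < 1" for a b
  proof -
    have "elliptic_K a < elliptic_K b" "0 < elliptic_K a"
      using that by (auto intro!: elliptic_K_strict_mono elliptic_K_pos)
    moreover have "a\<^sup>2 < b\<^sup>2" using that by (simp add: power2_strict_mono)
    hence "elliptic_K' b < elliptic_K' a"
      unfolding elliptic_K'_def using that complementary_modulus[of a] complementary_modulus[of b]
      by (intro elliptic_K_strict_mono) auto
    ultimately show ?thesis using K'pos[of b] that by (intro frac_less) auto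
  qed
  have cont: "continuous_on {0<..<1} ?f"
  proof (intro continuous_on_divide)
    show "continuous_on {0<..<1} elliptic_K"
      by (rule continuous_on_subset [OF elliptic_K_continuous_on]) auto
    show "continuous_on {0<..<1} elliptic_K'"
      unfolding elliptic_K'_def [abs_def]
      by (rule continuous_on_compose2 [OF elliptic_K_continuous_on])
         (auto intro!: continuous_intros simp: complementary_modulus abs_square_le_1)
    show "\<forall>l\<in>{0<..<1}. elliptic_K' l \<noteq> 0" using K'pos by force
  qed
  define h :: real where "h = sqrt (1 / 2)"
  have h: "0 < h" "h < 1" "sqrt (1 - h\<^sup>2) = h" by (simp_all add: h_def)
  have fh: "?f h = 1" using elliptic_K_pos[of h] h by (simp add: elliptic_K'_def)
  define a where "a = min h (pi / (2 * exp (elliptic_K h / q)))"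
  have a: "0 < a" "a \<le> h" using h by (auto simp: a_def)
  have "?f a \<le> q"
  proof -
    have "a \<le> pi / (2 * exp (elliptic_K h / q))" by (simp add: a_def)
    hence "exp (elliptic_K h / q) \<le> 1 + pi / (2 * a)" using a by (simp add: field_simps)
    hence "elliptic_K h / q \<le> ln (1 + pi / (2 * a))"
      using a by (subst ln_ge_iff) (auto intro!: add_pos_pos)
    also have "\<dots> \<le> elliptic_K' a"
      using elliptic_K_ge_ln[of "sqrt (1 - a\<^sup>2)"] complementary_modulus[of a] a h by (simp add: elliptic_K'_def)
    finally have "elliptic_K h \<le> q * elliptic_K' a" using q by (simp add: field_simps)
    moreover have "elliptic_K a \<le> elliptic_K h"
      using elliptic_K_strict_mono[of a h] a h by (cases "a = h") auto
    ultimately show ?thesis using K'pos[of a] a h by (simp add: field_simps)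
  qed
  moreover have "q \<le> ?f h" using q fh by simp
  moreover have "continuous_on {a..h} ?f" by (rule continuous_on_subset [OF cont]) (use a h in auto)
  ultimately obtain l where l: "a \<le> l" "l \<le> h" "?f l = q"
    using IVT'[of ?f a q h] a by blast
  show ?thesis
  proof (rule ex1I[of _ l])
    show "0 < l \<and> l < 1 \<and> ?f l = q" using l a h by auto
    fix l2 assume "0 < l2 \<and> l2 < 1 \<and> ?f l2 = q"
    thus "l2 = l" using mono[of l l2] mono[of l2 l] l a h by (cases l l2 rule: linorder_cases) auto
  qed
qed

section \<open>Jacobi functions on the complex plane\<close>

text \<open>Two meromorphic functions that agree on the real line agree outside a discrete set. The normalization of the
  values at the poles makes them equal everywhere.\<close>

lemma meromorphic_extension_eqI:
  assumes f: "f nicely_meromorphic_on UNIV" "\<And>x. f (complex_of_real x) = complex_of_real (g x)"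
  shows "meromorphic_extension g = f"
  unfolding meromorphic_extension_def
proof (rule the_equality)
  show "f nicely_meromorphic_on UNIV \<and> (\<forall>x. f (complex_of_real x) = complex_of_real (g x))"
    using f by blast
next
  fix h assume h: "h nicely_meromorphic_on UNIV \<and> (\<forall>x. h (complex_of_real x) = complex_of_real (g x))"
  have eq: "f (of_real x) = h (of_real x)" for x using f h by simp
  have "(\<lambda>z. f z - h z) meromorphic_on UNIV"
    using f h by (intro meromorphic_intros) (auto simp: nicely_meromorphic_on_def)
  hence "(\<forall>\<^sub>\<approx>z\<in>UNIV. f z - h z = 0) \<or> (\<forall>\<^sub>\<approx>z\<in>UNIV. f z - h z \<noteq> 0)"
    by (rule meromorphic_imp_constant_or_avoid) auto
  moreover have "\<not> (\<forall>\<^sub>\<approx>z\<in>UNIV. f z - h z \<noteq> 0)"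
  proof
    assume "\<forall>\<^sub>\<approx>z\<in>UNIV. f z - h z \<noteq> 0"
    hence "eventually (\<lambda>z. f z - h z \<noteq> 0) (at 0)"
      by (simp add: eventually_cosparse_open_eq)
    then obtain e where e: "e > 0" "\<And>z. z \<noteq> 0 \<Longrightarrow> dist z 0 < e \<Longrightarrow> f z - h z \<noteq> 0"
      unfolding eventually_at by blast
    show False using e(2)[of "of_real (e / 2)"] e(1) eq[of "e / 2"] by simp
  qed
  ultimately have ev: "eventually (\<lambda>w. f w = h w) (at z)" for z
    by (auto simp: eventually_cosparse_open_eq)
  show "h = f"
  proof
    fix z
    have pole: "is_pole f z \<longleftrightarrow> is_pole h z" by (rule is_pole_cong [OF ev refl])
    show "h z = f z"
    proof (cases "is_pole f z")
      case True
      thus ?thesis using is_pole_zero_at_nicely_mero[of f UNIV z] is_pole_zero_at_nicely_mero[of h UNIV z]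
        f h pole by simp
    next
      case False
      hence "f \<midarrow>z\<rightarrow> f z" "h \<midarrow>z\<rightarrow> h z" using f h pole by (auto simp: nicely_meromorphic_on_def)
      moreover from this(1) have "h \<midarrow>z\<rightarrow> f z" using tendsto_cong[OF ev] by simp
      ultimately show ?thesis using LIM_unique by blast
    qed
  qed
qed

text \<open>Quotient rule with the Cauchy--Riemann equations, in a form where the derivative of the
  quotient is read off from the partial derivatives of numerator and denominator.\<close>

lemma has_field_derivative_quotient_CR:
  fixes N D :: "complex \<Rightarrow> complex"
  assumes N: "(N has_derivative (\<lambda>h. Nx * of_real (Re h) + Ny * of_real (Im h))) (at z)"
    and D: "(D has_derivative (\<lambda>h. Dx * of_real (Re h) + Dy * of_real (Im h))) (at z)"
    and nz: "D z \<noteq> 0"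
    and x: "Nx * D z - N z * Dx = P" and y: "Ny * D z - N z * Dy = \<i> * P"
  shows "((\<lambda>z. N z / D z) has_field_derivative P / (D z)\<^sup>2) (at z)"
proof -
  have "((\<lambda>z. N z / D z) has_derivative (\<lambda>h. ((Nx * of_real (Re h) + Ny * of_real (Im h)) * D z
      - N z * (Dx * of_real (Re h) + Dy * of_real (Im h))) / (D z * D z))) (at z)"
    by (rule has_derivative_divide' [OF N D nz])
  also have "(\<lambda>h. ((Nx * of_real (Re h) + Ny * of_real (Im h)) * D z
      - N z * (Dx * of_real (Re h) + Dy * of_real (Im h))) / (D z * D z)) = (*) (P / (D z)\<^sup>2)"
  proof
    fix h :: complex
    have "(Nx * of_real (Re h) + Ny * of_real (Im h)) * D z - N z * (Dx * of_real (Re h) + Dy * of_real (Im h))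
      = (Nx * D z - N z * Dx) * of_real (Re h) + (Ny * D z - N z * Dy) * of_real (Im h)"
      by (simp add: algebra_simps)
    also have "\<dots> = P * (of_real (Re h) + \<i> * of_real (Im h))"
      unfolding x y by (simp add: algebra_simps)
    also have "of_real (Re h) + \<i> * of_real (Im h) = h" by (simp add: complex_eq_iff)
    finally show "((Nx * of_real (Re h) + Ny * of_real (Im h)) * D z
      - N z * (Dx * of_real (Re h) + Dy * of_real (Im h))) / (D z * D z) = (P / (D z)\<^sup>2) * h"
      by (simp add: power2_eq_square)
  qed
  finally show ?thesis by (simp only: has_field_derivative_def)
qed

lemma has_derivative_real_product:
  fixes f g :: "real \<Rightarrow> real"
  assumes f: "(f has_real_derivative f') (at (Re z))" and g: "(g has_real_derivative g') (at (Im z))"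
  shows "((\<lambda>z. complex_of_real (f (Re z) * g (Im z))) has_derivative
     (\<lambda>h. of_real (f' * g (Im z)) * of_real (Re h) + of_real (f (Re z) * g') * of_real (Im h))) (at z)"
proof -
  have f1: "((\<lambda>z. f (Re z)) has_derivative (\<lambda>h. f' * Re h)) (at z)"
    using has_derivative_compose[OF has_derivative_Re[OF has_derivative_ident] f[unfolded has_field_derivative_def]]
    by simp
  have g1: "((\<lambda>z. g (Im z)) has_derivative (\<lambda>h. g' * Im h)) (at z)"
    using has_derivative_compose[OF has_derivative_Im[OF has_derivative_ident] g[unfolded has_field_derivative_def]]
    by simp
  show ?thesis
    by (rule has_derivative_eq_rhs [OF has_derivative_of_real [OF has_derivative_mult [OF f1 g1]]])
       (simp add: fun_eq_iff algebra_simps)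
qed

lemma is_pole_real_quotient:
  assumes f: "\<And>z. (cmod (f z))\<^sup>2 = g z / q z" and g: "isCont g p" "0 < g p"
    and q: "isCont q p" "q p = 0" "eventually (\<lambda>z. 0 < q z) (at p)"
  shows "is_pole f p"
proof -
  have "filterlim (\<lambda>z. g z / q z) at_top (at p)"
    using filterlim_tendsto_pos_mult_at_top[of g "g p" "at p" "\<lambda>z. inverse (q z)"] g q
      filterlim_inverse_at_top[of q "at p"] by (simp add: isCont_def divide_inverse)
  hence "filterlim (\<lambda>z. sqrt ((cmod (f z))\<^sup>2)) at_top (at p)"
    unfolding f by (rule filterlim_compose [OF sqrt_at_top])
  thus ?thesis by (simp add: is_pole_def filterlim_at_infinity_conv_norm_at_top)
qed

text \<open>The addition formulas with Jacobi's imaginary transformation express the elliptic functions at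
  \<open>x + \<i> y\<close> by real ones: those of modulus \<open>l\<close> at \<open>x\<close> and those of the complementary
  modulus at \<open>y\<close>. These formulas, with their common denominator, serve as definition. At a pole the
  denominator vanishes, and division by \<open>0\<close> gives the value \<open>0\<close>.\<close>

definition jacobi_denom :: "real \<Rightarrow> complex \<Rightarrow> real" where
  "jacobi_denom l z = (re_cn (sqrt (1 - l\<^sup>2)) (Im z))\<^sup>2
     + l\<^sup>2 * (re_sn l (Re z))\<^sup>2 * (re_sn (sqrt (1 - l\<^sup>2)) (Im z))\<^sup>2"

definition cx_sn :: "real \<Rightarrow> complex \<Rightarrow> complex" where
  "cx_sn l z = (let m = sqrt (1 - l\<^sup>2); x = Re z; y = Im z in
     Complex (re_sn l x * re_dn m y) (re_cn l x * re_dn l x * (re_sn m y * re_cn m y)) / of_real (jacobi_denom l z))"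

definition cx_cn :: "real \<Rightarrow> complex \<Rightarrow> complex" where
  "cx_cn l z = (let m = sqrt (1 - l\<^sup>2); x = Re z; y = Im z in
     Complex (re_cn l x * re_cn m y) (- (re_sn l x * re_dn l x * (re_sn m y * re_dn m y))) / of_real (jacobi_denom l z))"

definition cx_dn :: "real \<Rightarrow> complex \<Rightarrow> complex" where
  "cx_dn l z = (let m = sqrt (1 - l\<^sup>2); x = Re z; y = Im z in
     Complex (re_dn l x * (re_cn m y * re_dn m y)) (- (l\<^sup>2 * (re_sn l x * re_cn l x * re_sn m y))) / of_real (jacobi_denom l z))"

lemma Complex_quotient_power2: "(cmod (Complex a b / of_real q))\<^sup>2 = (a\<^sup>2 + b\<^sup>2) / q\<^sup>2"
  by (simp add: norm_divide power_divide cmod_power2)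

text \<open>A quarter of a period rectangle of \<open>sn\<close>, whose periods are \<open>4 K\<close> and \<open>2 \<i> K'\<close>; its lower side is
  centred at \<open>0\<close>.\<close>

definition sn_rectangle :: "real \<Rightarrow> complex set" where
  "sn_rectangle l = {z. \<bar>Re z\<bar> < elliptic_K l \<and> 0 < Im z \<and> Im z < elliptic_K' l}"

lemma derivative_nonzero_isolated_value:
  fixes f :: "real \<Rightarrow> real"
  assumes "(f has_real_derivative D) (at x)" "D \<noteq> 0"
  obtains e where "0 < e" "\<And>y. y \<noteq> x \<Longrightarrow> \<bar>y - x\<bar> < e \<Longrightarrow> f y \<noteq> f x"
proof -
  have "((\<lambda>y. (f y - f x) / (y - x)) \<longlongrightarrow> D) (at x)"
    using assms(1) by (simp add: has_field_derivative_iff)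
  hence "eventually (\<lambda>y. (f y - f x) / (y - x) \<noteq> 0) (at x)"
    using assms(2) by (rule tendsto_imp_eventually_ne)
  then obtain e where e: "e > 0" "\<And>y. y \<noteq> x \<Longrightarrow> dist y x < e \<Longrightarrow> (f y - f x) / (y - x) \<noteq> 0"
    unfolding eventually_at by blast
  show ?thesis by (rule that[OF e(1)]) (use e(2) in \<open>auto simp: dist_real_def\<close>)
qed

context
  fixes l :: real
  assumes l: "0 < l" "l < 1"
begin

private lemma m: "0 < sqrt (1 - l\<^sup>2)" "sqrt (1 - l\<^sup>2) < 1" "(sqrt (1 - l\<^sup>2))\<^sup>2 = 1 - l\<^sup>2"
  using complementary_modulus[OF l] l by (simp_all add: abs_square_le_1)

private lemma l0: "0 \<le> l" and m0: "0 \<le> sqrt (1 - l\<^sup>2)"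
  using l m by auto

text \<open>Modulo these relations, the algebraic identities between \<open>sn\<close>, \<open>cn\<close> and \<open>dn\<close> on the plane and the
  Cauchy--Riemann equations for them become identities between polynomials in the real Jacobi functions.\<close>

private lemma rel:
  "(re_cn l x)\<^sup>2 = 1 - (re_sn l x)\<^sup>2" "(re_dn l x)\<^sup>2 = 1 - l\<^sup>2 * (re_sn l x)\<^sup>2"
  "(re_cn (sqrt (1 - l\<^sup>2)) y)\<^sup>2 = 1 - (re_sn (sqrt (1 - l\<^sup>2)) y)\<^sup>2"
  "(re_dn (sqrt (1 - l\<^sup>2)) y)\<^sup>2 = 1 - (1 - l\<^sup>2) * (re_sn (sqrt (1 - l\<^sup>2)) y)\<^sup>2"
  using re_cn_squared re_dn_squared[OF l0 l(2)] re_dn_squared[OF m0 m(2)] by (simp_all add: m(3))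

lemma jacobi_denom_nonneg: "0 \<le> jacobi_denom l z"
  by (simp add: jacobi_denom_def)

lemma jacobi_denom_eq_0:
  "jacobi_denom l z = 0 \<longleftrightarrow> re_cn (sqrt (1 - l\<^sup>2)) (Im z) = 0 \<and> re_sn l (Re z) = 0"
proof -
  have "jacobi_denom l z = 0 \<longleftrightarrow> re_cn (sqrt (1 - l\<^sup>2)) (Im z) = 0 \<and>
          l\<^sup>2 * (re_sn l (Re z))\<^sup>2 * (re_sn (sqrt (1 - l\<^sup>2)) (Im z))\<^sup>2 = 0"
    unfolding jacobi_denom_def by (subst add_nonneg_eq_0_iff) auto
  also have "\<dots> \<longleftrightarrow> re_cn (sqrt (1 - l\<^sup>2)) (Im z) = 0 \<and> re_sn l (Re z) = 0"
    using rel(3)[of "Im z"] l by auto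
  finally show ?thesis .
qed

lemma cx_sn_norm: "(cmod (cx_sn l z))\<^sup>2 =
    (1 - (re_cn l (Re z))\<^sup>2 * (re_cn (sqrt (1 - l\<^sup>2)) (Im z))\<^sup>2) / jacobi_denom l z"
proof -
  have "(re_sn l (Re z) * re_dn (sqrt (1 - l\<^sup>2)) (Im z))\<^sup>2 +
     (re_cn l (Re z) * re_dn l (Re z) * (re_sn (sqrt (1 - l\<^sup>2)) (Im z) * re_cn (sqrt (1 - l\<^sup>2)) (Im z)))\<^sup>2
     = (1 - (re_cn l (Re z))\<^sup>2 * (re_cn (sqrt (1 - l\<^sup>2)) (Im z))\<^sup>2) * jacobi_denom l z"
    using rel(1,2)[of "Re z"] rel(3,4)[of "Im z"] unfolding jacobi_denom_def by algebra
  thus ?thesis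
    unfolding cx_sn_def Let_def Complex_quotient_power2 by (simp add: power2_eq_square)
qed

lemma cx_cn_norm: "(cmod (cx_cn l z))\<^sup>2 =
    (1 - (re_sn l (Re z))\<^sup>2 * (re_dn (sqrt (1 - l\<^sup>2)) (Im z))\<^sup>2) / jacobi_denom l z"
proof -
  have "(re_cn l (Re z) * re_cn (sqrt (1 - l\<^sup>2)) (Im z))\<^sup>2 +
     (- (re_sn l (Re z) * re_dn l (Re z) * (re_sn (sqrt (1 - l\<^sup>2)) (Im z) * re_dn (sqrt (1 - l\<^sup>2)) (Im z))))\<^sup>2
     = (1 - (re_sn l (Re z))\<^sup>2 * (re_dn (sqrt (1 - l\<^sup>2)) (Im z))\<^sup>2) * jacobi_denom l z"
    using rel(1,2)[of "Re z"] rel(3,4)[of "Im z"] unfolding jacobi_denom_def by algebra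
  thus ?thesis
    unfolding cx_cn_def Let_def Complex_quotient_power2 by (simp add: power2_eq_square)
qed

lemma cx_dn_norm: "(cmod (cx_dn l z))\<^sup>2 =
    (1 - l\<^sup>2 * (re_sn l (Re z))\<^sup>2 - (1 - l\<^sup>2) * (re_sn (sqrt (1 - l\<^sup>2)) (Im z))\<^sup>2) / jacobi_denom l z"
proof -
  have "(re_dn l (Re z) * (re_cn (sqrt (1 - l\<^sup>2)) (Im z) * re_dn (sqrt (1 - l\<^sup>2)) (Im z)))\<^sup>2 +
     (- (l\<^sup>2 * (re_sn l (Re z) * re_cn l (Re z) * re_sn (sqrt (1 - l\<^sup>2)) (Im z))))\<^sup>2
     = (1 - l\<^sup>2 * (re_sn l (Re z))\<^sup>2 - (1 - l\<^sup>2) * (re_sn (sqrt (1 - l\<^sup>2)) (Im z))\<^sup>2) * jacobi_denom l z"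
    using rel(1,2)[of "Re z"] rel(3,4)[of "Im z"] unfolding jacobi_denom_def by algebra
  thus ?thesis
    unfolding cx_dn_def Let_def Complex_quotient_power2 by (simp add: power2_eq_square)
qed

lemma cx_sn_cn_dn_relations:
  assumes "jacobi_denom l z \<noteq> 0"
  shows "(cx_cn l z)\<^sup>2 = 1 - (cx_sn l z)\<^sup>2" "(cx_dn l z)\<^sup>2 = 1 - (of_real l)\<^sup>2 * (cx_sn l z)\<^sup>2"
proof -
  let ?s = "re_sn l (Re z)" and ?c = "re_cn l (Re z)" and ?d = "re_dn l (Re z)"
  let ?s1 = "re_sn (sqrt (1 - l\<^sup>2)) (Im z)" and ?c1 = "re_cn (sqrt (1 - l\<^sup>2)) (Im z)" and ?d1 = "re_dn (sqrt (1 - l\<^sup>2)) (Im z)"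
  let ?q = "jacobi_denom l z"
  have sq: "(Complex a b / of_real ?q)\<^sup>2 = Complex (a\<^sup>2 - b\<^sup>2) (2 * a * b) / of_real (?q\<^sup>2)" for a b
    by (simp add: power_divide complex_eq_iff power2_eq_square)
  note rels = rel(1,2)[of "Re z"] rel(3,4)[of "Im z"] jacobi_denom_def[of l z]
  have "(?c * ?c1)\<^sup>2 - (- (?s * ?d * (?s1 * ?d1)))\<^sup>2 = ?q\<^sup>2 - ((?s * ?d1)\<^sup>2 - (?c * ?d * (?s1 * ?c1))\<^sup>2)"
    using rels by algebra
  moreover have "2 * (?c * ?c1) * (- (?s * ?d * (?s1 * ?d1))) = - (2 * (?s * ?d1) * (?c * ?d * (?s1 * ?c1)))"
    by (simp add: algebra_simps)
  ultimately show "(cx_cn l z)\<^sup>2 = 1 - (cx_sn l z)\<^sup>2"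
    unfolding cx_cn_def cx_sn_def Let_def sq using assms
    by (simp add: complex_eq_iff diff_divide_distrib)
  have "(?d * (?c1 * ?d1))\<^sup>2 - (- (l\<^sup>2 * (?s * ?c * ?s1)))\<^sup>2 = ?q\<^sup>2 - l\<^sup>2 * ((?s * ?d1)\<^sup>2 - (?c * ?d * (?s1 * ?c1))\<^sup>2)"
    using rels by algebra
  moreover have "2 * (?d * (?c1 * ?d1)) * (- (l\<^sup>2 * (?s * ?c * ?s1))) = - (l\<^sup>2 * (2 * (?s * ?d1) * (?c * ?d * (?s1 * ?c1))))"
    by (simp add: algebra_simps)
  ultimately show "(cx_dn l z)\<^sup>2 = 1 - (of_real l)\<^sup>2 * (cx_sn l z)\<^sup>2"
    unfolding cx_dn_def cx_sn_def Let_def sq using assms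
    by (simp add: complex_eq_iff diff_divide_distrib)
qed

private lemma x_derivs:
  "((\<lambda>x. re_sn l x) has_real_derivative re_cn l x * re_dn l x) (at x)"
  "((\<lambda>x. re_cn l x) has_real_derivative - re_sn l x * re_dn l x) (at x)"
  "((\<lambda>x. re_dn l x) has_real_derivative - l\<^sup>2 * re_sn l x * re_cn l x) (at x)"
  "((\<lambda>x. re_sn (sqrt (1 - l\<^sup>2)) x) has_real_derivative re_cn (sqrt (1 - l\<^sup>2)) x * re_dn (sqrt (1 - l\<^sup>2)) x) (at x)"
  "((\<lambda>x. re_cn (sqrt (1 - l\<^sup>2)) x) has_real_derivative - re_sn (sqrt (1 - l\<^sup>2)) x * re_dn (sqrt (1 - l\<^sup>2)) x) (at x)"
  "((\<lambda>x. re_dn (sqrt (1 - l\<^sup>2)) x) has_real_derivative - (1 - l\<^sup>2) * re_sn (sqrt (1 - l\<^sup>2)) x * re_cn (sqrt (1 - l\<^sup>2)) x) (at x)"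
  using re_sn_deriv[OF l0 l(2)] re_cn_deriv[OF l0 l(2)] re_dn_deriv[OF l0 l(2)]
    re_sn_deriv[OF m0 m(2)] re_cn_deriv[OF m0 m(2)] re_dn_deriv[OF m0 m(2)] by (simp_all add: m(3))



text \<open>The Cauchy--Riemann equations for a quotient with the common denominator of the three functions. Numerators
  have the form \<open>a(x) b(y) + \<i> f(x) g(y)\<close>; \<open>qx\<close> and \<open>qy\<close> are the partial derivatives of the denominator.\<close>

private lemma quotient_deriv:
  assumes a: "(a has_real_derivative a') (at (Re z))" and b: "(b has_real_derivative b') (at (Im z))"
    and f: "(f has_real_derivative f') (at (Re z))" and g: "(g has_real_derivative g') (at (Im z))"
    and nz: "jacobi_denom l z \<noteq> 0"
  defines "qx \<equiv> 2 * l\<^sup>2 * re_sn l (Re z) * (re_cn l (Re z) * re_dn l (Re z)) * (re_sn (sqrt (1 - l\<^sup>2)) (Im z))\<^sup>2"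
    and "qy \<equiv> 2 * re_sn (sqrt (1 - l\<^sup>2)) (Im z) * re_cn (sqrt (1 - l\<^sup>2)) (Im z) * re_dn (sqrt (1 - l\<^sup>2)) (Im z)
                 * (l\<^sup>2 * (re_sn l (Re z))\<^sup>2 - 1)"
  assumes eqs: "a' * b (Im z) * jacobi_denom l z - a (Re z) * b (Im z) * qx = P1"
    "f' * g (Im z) * jacobi_denom l z - f (Re z) * g (Im z) * qx = P2"
    "a (Re z) * b' * jacobi_denom l z - a (Re z) * b (Im z) * qy = - P2"
    "f (Re z) * g' * jacobi_denom l z - f (Re z) * g (Im z) * qy = P1"
  shows "((\<lambda>z. Complex (a (Re z) * b (Im z)) (f (Re z) * g (Im z)) / of_real (jacobi_denom l z))
    has_field_derivative Complex P1 P2 / of_real ((jacobi_denom l z)\<^sup>2)) (at z)"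
proof -
  let ?m = "sqrt (1 - l\<^sup>2)"
  let ?N = "\<lambda>z. of_real (a (Re z) * b (Im z)) + \<i> * of_real (f (Re z) * g (Im z)) :: complex"
  let ?D = "\<lambda>z. of_real (1 * (re_cn ?m (Im z))\<^sup>2) + of_real (l\<^sup>2 * (re_sn l (Re z))\<^sup>2 * (re_sn ?m (Im z))\<^sup>2) :: complex"
  have D: "?D z = of_real (jacobi_denom l z)" for z by (simp add: jacobi_denom_def)
  have N: "?N z = Complex (a (Re z) * b (Im z)) (f (Re z) * g (Im z))" for z
    by (simp add: complex_eq_iff)
  have dN: "(?N has_derivative (\<lambda>h. (of_real (a' * b (Im z)) + \<i> * of_real (f' * g (Im z))) * of_real (Re h)
      + (of_real (a (Re z) * b') + \<i> * of_real (f (Re z) * g')) * of_real (Im h))) (at z)"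
    by (rule has_derivative_eq_rhs [OF has_derivative_add [OF has_derivative_real_product [OF a b]
          has_derivative_mult_right [OF has_derivative_real_product [OF f g]]]])
       (simp add: fun_eq_iff algebra_simps)
  have c2: "((\<lambda>y. (re_cn ?m y)\<^sup>2) has_real_derivative 2 * re_cn ?m y * (- re_sn ?m y * re_dn ?m y)) (at y)"
   and s2: "((\<lambda>y. (re_sn ?m y)\<^sup>2) has_real_derivative 2 * re_sn ?m y * (re_cn ?m y * re_dn ?m y)) (at y)"
   and s3: "((\<lambda>x. l\<^sup>2 * (re_sn l x)\<^sup>2) has_real_derivative 2 * l\<^sup>2 * re_sn l x * (re_cn l x * re_dn l x)) (at x)" for x y
    by (auto intro!: derivative_eq_intros x_derivs)
  have dD: "(?D has_derivative (\<lambda>h. of_real qx * of_real (Re h) + of_real qy * of_real (Im h))) (at z)"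
    by (rule has_derivative_eq_rhs [OF has_derivative_add [OF has_derivative_real_product [OF DERIV_const c2]
          has_derivative_real_product [OF s3 s2]]])
       (simp add: fun_eq_iff algebra_simps power2_eq_square qx_def qy_def)
  have "((\<lambda>z. ?N z / ?D z) has_field_derivative Complex P1 P2 / (?D z)\<^sup>2) (at z)"
  proof (rule has_field_derivative_quotient_CR [OF dN dD])
    show "?D z \<noteq> 0" unfolding D using nz by simp
    show "(of_real (a' * b (Im z)) + \<i> * of_real (f' * g (Im z))) * ?D z - ?N z * of_real qx = Complex P1 P2"
      unfolding D eqs(1,2) [symmetric] by (simp add: complex_eq_iff)
    show "(of_real (a (Re z) * b') + \<i> * of_real (f (Re z) * g')) * ?D z - ?N z * of_real qy = \<i> * Complex P1 P2"
      unfolding D using eqs(3,4) by (simp add: complex_eq_iff)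
  qed
  thus ?thesis unfolding N D by simp
qed

lemma cx_sn_deriv:
  assumes nz: "jacobi_denom l z \<noteq> 0"
  shows "(cx_sn l has_field_derivative cx_cn l z * cx_dn l z) (at z)"
proof -
  let ?m = "sqrt (1 - l\<^sup>2)"
  let ?s = "re_sn l (Re z)" and ?c = "re_cn l (Re z)" and ?d = "re_dn l (Re z)"
  let ?s1 = "re_sn ?m (Im z)" and ?c1 = "re_cn ?m (Im z)" and ?d1 = "re_dn ?m (Im z)"
  \<comment> \<open>real and imaginary part of the product of the numerators of \<open>cn\<close> and \<open>dn\<close>\<close>
  define P1 where "P1 = ?c * ?c1 * (?d * (?c1 * ?d1)) - ?s * ?d * (?s1 * ?d1) * (l\<^sup>2 * (?s * ?c * ?s1))"
  define P2 where "P2 = - (?c * ?c1 * (l\<^sup>2 * (?s * ?c * ?s1)) + ?s * ?d * (?s1 * ?d1) * (?d * (?c1 * ?d1)))"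
  note rels = rel(1,2)[of "Re z"] rel(3,4)[of "Im z"]
  have d1: "((\<lambda>x. re_cn l x * re_dn l x) has_real_derivative - ?s * ?d * ?d + (- l\<^sup>2 * ?s * ?c) * ?c) (at (Re z))"
    by (rule DERIV_mult [OF x_derivs(2,3)])
  have d2: "((\<lambda>y. re_sn ?m y * re_cn ?m y) has_real_derivative ?c1 * ?d1 * ?c1 + (- ?s1 * ?d1) * ?s1) (at (Im z))"
    by (rule DERIV_mult [OF x_derivs(4,5)])
  have "((\<lambda>z. Complex (re_sn l (Re z) * re_dn ?m (Im z)) (re_cn l (Re z) * re_dn l (Re z) * (re_sn ?m (Im z) * re_cn ?m (Im z)))
      / of_real (jacobi_denom l z)) has_field_derivative Complex P1 P2 / of_real ((jacobi_denom l z)\<^sup>2)) (at z)"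
    by (rule quotient_deriv [OF x_derivs(1) x_derivs(6) d1 d2 nz]) (unfold P1_def P2_def jacobi_denom_def, (use rels in algebra)+)
  moreover have "Complex P1 P2 / of_real ((jacobi_denom l z)\<^sup>2) = cx_cn l z * cx_dn l z"
    by (simp add: cx_cn_def cx_dn_def Let_def P1_def P2_def power2_eq_square complex_eq_iff mult.commute)
  ultimately show ?thesis by (simp add: cx_sn_def [abs_def] Let_def)
qed

lemma cx_cn_differentiable:
  assumes nz: "jacobi_denom l z \<noteq> 0"
  shows "cx_cn l field_differentiable at z"
proof -
  let ?m = "sqrt (1 - l\<^sup>2)"
  let ?s = "re_sn l (Re z)" and ?c = "re_cn l (Re z)" and ?d = "re_dn l (Re z)"
  let ?s1 = "re_sn ?m (Im z)" and ?c1 = "re_cn ?m (Im z)" and ?d1 = "re_dn ?m (Im z)"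
  \<comment> \<open>likewise for \<open>- sn dn\<close>\<close>
  define P1 where "P1 = - (?s * ?d1 * (?d * (?c1 * ?d1)) + ?c * ?d * (?s1 * ?c1) * (l\<^sup>2 * (?s * ?c * ?s1)))"
  define P2 where "P2 = ?s * ?d1 * (l\<^sup>2 * (?s * ?c * ?s1)) - ?c * ?d * (?s1 * ?c1) * (?d * (?c1 * ?d1))"
  note rels = rel(1,2)[of "Re z"] rel(3,4)[of "Im z"]
  have d1: "((\<lambda>x. - (re_sn l x * re_dn l x)) has_real_derivative - (?c * ?d * ?d + (- l\<^sup>2 * ?s * ?c) * ?s)) (at (Re z))"
    by (rule DERIV_minus [OF DERIV_mult [OF x_derivs(1,3)]])
  have d2: "((\<lambda>y. re_sn ?m y * re_dn ?m y) has_real_derivative ?c1 * ?d1 * ?d1 + (- (1 - l\<^sup>2) * ?s1 * ?c1) * ?s1) (at (Im z))"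
    by (rule DERIV_mult [OF x_derivs(4,6)])
  have "((\<lambda>z. Complex (re_cn l (Re z) * re_cn ?m (Im z)) (- (re_sn l (Re z) * re_dn l (Re z)) * (re_sn ?m (Im z) * re_dn ?m (Im z)))
      / of_real (jacobi_denom l z)) has_field_derivative Complex P1 P2 / of_real ((jacobi_denom l z)\<^sup>2)) (at z)"
    by (rule quotient_deriv [OF x_derivs(2) x_derivs(5) d1 d2 nz]) (unfold P1_def P2_def jacobi_denom_def, (use rels in algebra)+)
  thus ?thesis unfolding field_differentiable_def by (auto simp: cx_cn_def [abs_def] Let_def)
qed

lemma cx_dn_differentiable:
  assumes nz: "jacobi_denom l z \<noteq> 0"
  shows "cx_dn l field_differentiable at z"
proof -
  let ?m = "sqrt (1 - l\<^sup>2)"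
  let ?s = "re_sn l (Re z)" and ?c = "re_cn l (Re z)" and ?d = "re_dn l (Re z)"
  let ?s1 = "re_sn ?m (Im z)" and ?c1 = "re_cn ?m (Im z)" and ?d1 = "re_dn ?m (Im z)"
  \<comment> \<open>likewise for \<open>- l\<^sup>2 sn cn\<close>\<close>
  define P1 where "P1 = - l\<^sup>2 * (?s * ?d1 * (?c * ?c1) + ?c * ?d * (?s1 * ?c1) * (?s * ?d * (?s1 * ?d1)))"
  define P2 where "P2 = l\<^sup>2 * (?s * ?d1 * (?s * ?d * (?s1 * ?d1)) - ?c * ?d * (?s1 * ?c1) * (?c * ?c1))"
  note rels = rel(1,2)[of "Re z"] rel(3,4)[of "Im z"]
  have d1: "((\<lambda>x. - l\<^sup>2 * (re_sn l x * re_cn l x)) has_real_derivative - l\<^sup>2 * (?c * ?d * ?c + (- ?s * ?d) * ?s)) (at (Re z))"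
    by (rule DERIV_cmult [OF DERIV_mult [OF x_derivs(1,2)]])
  have d2: "((\<lambda>y. re_cn ?m y * re_dn ?m y) has_real_derivative - ?s1 * ?d1 * ?d1 + (- (1 - l\<^sup>2) * ?s1 * ?c1) * ?c1) (at (Im z))"
    by (rule DERIV_mult [OF x_derivs(5,6)])
  have "((\<lambda>z. Complex (re_dn l (Re z) * (re_cn ?m (Im z) * re_dn ?m (Im z))) (- l\<^sup>2 * (re_sn l (Re z) * re_cn l (Re z)) * re_sn ?m (Im z))
      / of_real (jacobi_denom l z)) has_field_derivative Complex P1 P2 / of_real ((jacobi_denom l z)\<^sup>2)) (at z)"
    by (rule quotient_deriv [OF x_derivs(3) d2 d1 x_derivs(4) nz]) (unfold P1_def P2_def jacobi_denom_def, (use rels in algebra)+)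
  thus ?thesis unfolding field_differentiable_def by (auto simp: cx_dn_def [abs_def] Let_def mult.assoc)
qed


private lemma cont:
  "continuous_on A f \<Longrightarrow> continuous_on A (\<lambda>z. re_sn l (f z))"
  "continuous_on A f \<Longrightarrow> continuous_on A (\<lambda>z. re_cn l (f z))"
  "continuous_on A f \<Longrightarrow> continuous_on A (\<lambda>z. re_dn l (f z))"
  "continuous_on A f \<Longrightarrow> continuous_on A (\<lambda>z. re_sn (sqrt (1 - l\<^sup>2)) (f z))"
  "continuous_on A f \<Longrightarrow> continuous_on A (\<lambda>z. re_cn (sqrt (1 - l\<^sup>2)) (f z))"
  "continuous_on A f \<Longrightarrow> continuous_on A (\<lambda>z. re_dn (sqrt (1 - l\<^sup>2)) (f z))"
proof -
  have *: "continuous_on UNIV g" if "\<And>x. \<exists>D. (g has_real_derivative D) (at x)" for g :: "real \<Rightarrow> real"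
    using that by (metis DERIV_isCont continuous_at_imp_continuous_on)
  note c = continuous_on_compose2[OF * _ subset_UNIV]
  show "continuous_on A f \<Longrightarrow> continuous_on A (\<lambda>z. re_sn l (f z))"
    by (rule c) (use re_sn_deriv[OF l0 l(2)] in blast)+
  show "continuous_on A f \<Longrightarrow> continuous_on A (\<lambda>z. re_cn l (f z))"
    by (rule c) (use re_cn_deriv[OF l0 l(2)] in blast)+
  show "continuous_on A f \<Longrightarrow> continuous_on A (\<lambda>z. re_dn l (f z))"
    by (rule c) (use re_dn_deriv[OF l0 l(2)] in blast)+
  show "continuous_on A f \<Longrightarrow> continuous_on A (\<lambda>z. re_sn (sqrt (1 - l\<^sup>2)) (f z))"
    by (rule c) (use re_sn_deriv[OF m0 m(2)] in blast)+
  show "continuous_on A f \<Longrightarrow> continuous_on A (\<lambda>z. re_cn (sqrt (1 - l\<^sup>2)) (f z))"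
    by (rule c) (use re_cn_deriv[OF m0 m(2)] in blast)+
  show "continuous_on A f \<Longrightarrow> continuous_on A (\<lambda>z. re_dn (sqrt (1 - l\<^sup>2)) (f z))"
    by (rule c) (use re_dn_deriv[OF m0 m(2)] in blast)+
qed

lemma jacobi_denom_continuous: "continuous_on A (jacobi_denom l)"
  unfolding jacobi_denom_def [abs_def] by (intro continuous_intros cont)

lemma jacobi_denom_isolated_zeros: "eventually (\<lambda>z. 0 < jacobi_denom l z) (at p)"
proof (cases "jacobi_denom l p = 0")
  case False
  hence "0 < jacobi_denom l p" using jacobi_denom_nonneg[of p] by simp
  moreover have "(jacobi_denom l \<longlongrightarrow> jacobi_denom l p) (at p)"
    using jacobi_denom_continuous[of UNIV] by (simp add: continuous_on_eq_continuous_at isCont_def)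
  ultimately show ?thesis by (simp add: order_tendstoD(1))
next
  case True
  hence z: "re_cn (sqrt (1 - l\<^sup>2)) (Im p) = 0" "re_sn l (Re p) = 0" by (auto simp: jacobi_denom_eq_0)
  have "re_cn l (Re p) \<noteq> 0" using re_cn_squared[of l "Re p"] z by auto
  moreover have "re_dn l (Re p) \<noteq> 0" using re_dn_pos[OF l0 l(2), of "Re p"] by simp
  ultimately have "re_cn l (Re p) * re_dn l (Re p) \<noteq> 0" by simp
  then obtain e where e: "e > 0" "\<And>x. x \<noteq> Re p \<Longrightarrow> \<bar>x - Re p\<bar> < e \<Longrightarrow> re_sn l x \<noteq> 0"
    using derivative_nonzero_isolated_value[OF re_sn_deriv[OF l0 l(2)]] z(2) by metis
  have "re_sn (sqrt (1 - l\<^sup>2)) (Im p) \<noteq> 0" using re_cn_squared[of "sqrt (1 - l\<^sup>2)" "Im p"] z by auto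
  moreover have "re_dn (sqrt (1 - l\<^sup>2)) (Im p) \<noteq> 0" using re_dn_pos[OF m0 m(2), of "Im p"] by simp
  ultimately have "- re_sn (sqrt (1 - l\<^sup>2)) (Im p) * re_dn (sqrt (1 - l\<^sup>2)) (Im p) \<noteq> 0" by simp
  then obtain e' where e': "e' > 0" "\<And>y. y \<noteq> Im p \<Longrightarrow> \<bar>y - Im p\<bar> < e' \<Longrightarrow> re_cn (sqrt (1 - l\<^sup>2)) y \<noteq> 0"
    using derivative_nonzero_isolated_value[OF re_cn_deriv[OF m0 m(2)]] z(1) by metis
  have "0 < jacobi_denom l w" if w: "w \<noteq> p" "dist w p < min e e'" for w
  proof -
    have "\<bar>Re w - Re p\<bar> < e" "\<bar>Im w - Im p\<bar> < e'"
      using w(2) abs_Re_le_cmod[of "w - p"] abs_Im_le_cmod[of "w - p"] by (auto simp: dist_norm)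
    moreover have "Re w \<noteq> Re p \<or> Im w \<noteq> Im p" using w(1) by (auto simp: complex_eq_iff)
    ultimately have "jacobi_denom l w \<noteq> 0" using e(2) e'(2) jacobi_denom_eq_0 by blast
    thus ?thesis using jacobi_denom_nonneg[of w] by simp
  qed
  moreover have "0 < min e e'" using e(1) e'(1) by simp
  ultimately show ?thesis unfolding eventually_at by blast
qed

text \<open>The denominator has isolated zeros, and there the squared modulus, a positive function over the denominator,
  tends to infinity.\<close>

private lemma nicely_meromorphic:
  assumes diff: "\<And>z. jacobi_denom l z \<noteq> 0 \<Longrightarrow> f field_differentiable at z"
    and zero: "\<And>z. jacobi_denom l z = 0 \<Longrightarrow> f z = 0"
    and norm: "\<And>z. (cmod (f z))\<^sup>2 = g z / jacobi_denom l z"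
    and g: "continuous_on UNIV g" "\<And>z. jacobi_denom l z = 0 \<Longrightarrow> 0 < g z"
  shows "f nicely_meromorphic_on UNIV"
proof -
  let ?P = "{z. jacobi_denom l z = 0}"
  have "closed ?P"
    using continuous_closed_preimage_constant[OF jacobi_denom_continuous[of UNIV], of 0] by simp
  hence op: "open (UNIV - ?P)" by auto
  have "f holomorphic_on (UNIV - ?P)"
    using diff by (auto simp: holomorphic_on_def intro: field_differentiable_at_within)
  hence an: "f analytic_on (UNIV - ?P)" using op by (simp add: analytic_on_open)
  show ?thesis
  proof (rule nicely_meromorphic_onI_open [OF open_UNIV an])
    fix p assume "p \<in> ?P"
    hence p: "jacobi_denom l p = 0" by simp
    have "is_pole f p"
    proof (rule is_pole_real_quotient [OF norm])
      show "isCont g p" "isCont (jacobi_denom l) p"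
        using g(1) jacobi_denom_continuous[of UNIV] by (simp_all add: continuous_on_eq_continuous_at)
    qed (use g(2) p jacobi_denom_isolated_zeros in auto)
    thus "is_pole f p \<and> f p = 0" using zero[OF p] by simp
  next
    fix p :: complex
    obtain r where r: "r > 0" "\<And>w. w \<noteq> p \<Longrightarrow> dist w p < r \<Longrightarrow> 0 < jacobi_denom l w"
      using jacobi_denom_isolated_zeros[of p] unfolding eventually_at by blast
    have "ball p r - {p} \<subseteq> UNIV - ?P" using r(2) by (force simp: dist_commute)
    hence "f analytic_on ball p r - {p}" by (rule analytic_on_subset [OF an])
    thus "isolated_singularity_at f p" using r(1) unfolding isolated_singularity_at_def by blast
  qed
qed

lemma jacobi_sn_eq: "jacobi_sn l = cx_sn l"
  unfolding jacobi_sn_def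
proof (rule meromorphic_extension_eqI)
  show "cx_sn l nicely_meromorphic_on UNIV"
  proof (rule nicely_meromorphic [OF _ _ cx_sn_norm])
    show "cx_sn l field_differentiable at z" if "jacobi_denom l z \<noteq> 0" for z
      using cx_sn_deriv[OF that] by (auto simp: field_differentiable_def)
  qed (auto intro!: continuous_intros cont simp: jacobi_denom_eq_0 cx_sn_def Let_def)
  show "cx_sn l (complex_of_real x) = complex_of_real (sin (jacobi_am l x))" for x
    by (simp add: cx_sn_def jacobi_denom_def re_jacobi_0[OF m0 m(2)] re_sn_def[of l] complex_eq_iff)
qed

lemma jacobi_cn_eq: "jacobi_cn l = cx_cn l"
  unfolding jacobi_cn_def
proof (rule meromorphic_extension_eqI)
  show "cx_cn l nicely_meromorphic_on UNIV"
    by (rule nicely_meromorphic [OF cx_cn_differentiable _ cx_cn_norm])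
       (auto intro!: continuous_intros cont simp: jacobi_denom_eq_0 cx_cn_def Let_def)
  show "cx_cn l (complex_of_real x) = complex_of_real (cos (jacobi_am l x))" for x
    by (simp add: cx_cn_def jacobi_denom_def re_jacobi_0[OF m0 m(2)] re_cn_def[of l] complex_eq_iff)
qed

lemma jacobi_dn_eq: "jacobi_dn l = cx_dn l"
  unfolding jacobi_dn_def
proof (rule meromorphic_extension_eqI)
  show "cx_dn l nicely_meromorphic_on UNIV"
  proof (rule nicely_meromorphic [OF cx_dn_differentiable _ cx_dn_norm])
    fix z assume z: "jacobi_denom l z = 0"
    hence "re_cn (sqrt (1 - l\<^sup>2)) (Im z) = 0" "re_sn l (Re z) = 0" by (auto simp: jacobi_denom_eq_0)
    moreover from this(1) have "(re_sn (sqrt (1 - l\<^sup>2)) (Im z))\<^sup>2 = 1"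
      using re_cn_squared[of "sqrt (1 - l\<^sup>2)" "Im z"] by simp
    ultimately show "0 < 1 - l\<^sup>2 * (re_sn l (Re z))\<^sup>2 - (1 - l\<^sup>2) * (re_sn (sqrt (1 - l\<^sup>2)) (Im z))\<^sup>2"
      using l by simp
  qed (auto intro!: continuous_intros cont simp: cx_dn_def Let_def)
  have "deriv (jacobi_am l) x = re_dn l x" for x
    using jacobi_am_deriv[OF l0 l(2)] by (simp add: DERIV_imp_deriv re_dn_def re_sn_def)
  thus "cx_dn l (complex_of_real x) = complex_of_real (deriv (jacobi_am l) x)" for x
    by (simp add: cx_dn_def jacobi_denom_def re_jacobi_0[OF m0 m(2)] complex_eq_iff)
qed

section \<open>The conformal map sn\<close>

lemma sn_rectangle_eq_box: "(sn_rectangle l) = box (Complex (- elliptic_K l) 0) (Complex (elliptic_K l) (elliptic_K' l))"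
  by (auto simp: sn_rectangle_def in_box_complex_iff)

lemma sn_rectangle_open_convex: "open (sn_rectangle l)" "convex (sn_rectangle l)"
  by (simp_all add: sn_rectangle_eq_box open_box convex_box)

private lemma K': "elliptic_K' l = elliptic_K (sqrt (1 - l\<^sup>2))"
  by (simp add: elliptic_K'_def)

lemma sn_rectangle_pos:
  assumes "z \<in> sn_rectangle l"
  shows "0 < re_cn l (Re z)" "0 < re_dn l (Re z)" "0 < re_sn (sqrt (1 - l\<^sup>2)) (Im z)"
    "0 < re_cn (sqrt (1 - l\<^sup>2)) (Im z)" "0 < jacobi_denom l z"
proof -
  show "0 < re_cn l (Re z)" "0 < re_dn l (Re z)" "0 < re_sn (sqrt (1 - l\<^sup>2)) (Im z)"
    and c: "0 < re_cn (sqrt (1 - l\<^sup>2)) (Im z)"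
    using assms re_cn_pos[OF l0 l(2)] re_dn_pos[OF l0 l(2)] re_sn_pos[OF m0 m(2)] re_cn_pos[OF m0 m(2)]
    by (auto simp: sn_rectangle_def K')
  show "0 < jacobi_denom l z" using c by (simp add: jacobi_denom_def add_pos_nonneg)
qed

lemma cx_sn_upper: "z \<in> sn_rectangle l \<Longrightarrow> 0 < Im (cx_sn l z)"
  using sn_rectangle_pos[of z] by (simp add: cx_sn_def Let_def)

lemma cx_sn_holomorphic: "cx_sn l holomorphic_on (sn_rectangle l)"
  unfolding holomorphic_on_def
proof
  fix z assume "z \<in> sn_rectangle l"
  hence "jacobi_denom l z \<noteq> 0" using sn_rectangle_pos(5)[of z] by simp
  hence "cx_sn l field_differentiable at z" using cx_sn_deriv by (auto simp: field_differentiable_def)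
  thus "cx_sn l field_differentiable at z within (sn_rectangle l)" by (rule field_differentiable_at_within)
qed

text \<open>A primitive \<open>f\<close> of \<open>1 / sqrt ((1 - w\<^sup>2) (1 - l\<^sup>2 w\<^sup>2))\<close> on the upper half-plane
  inverts \<open>sn\<close>: the derivative of \<open>f \<circ> sn\<close> has square \<open>1\<close>, so it is constantly \<open>1\<close> or constantly \<open>- 1\<close>.\<close>

lemma cx_sn_inj: "inj_on (cx_sn l) (sn_rectangle l)"
proof -
  let ?H = "{w. 0 < Im w}"
  \<comment> \<open>each factor has its argument off the negative real axis, where \<open>csqrt\<close> is holomorphic\<close>
  define g where "g w = 1 / (csqrt (1 - w) * csqrt (1 + w) * csqrt (1 - of_real l * w) * csqrt (1 + of_real l * w))" for w
  have nr: "1 - w \<notin> \<real>\<^sub>\<le>\<^sub>0" "1 + w \<notin> \<real>\<^sub>\<le>\<^sub>0" "1 - of_real l * w \<notin> \<real>\<^sub>\<le>\<^sub>0" "1 + of_real l * w \<notin> \<real>\<^sub>\<le>\<^sub>0" if "w \<in> ?H" for w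
    using that l by (auto simp: complex_nonpos_Reals_iff)
  have nz: "1 - w \<noteq> 0" "1 + w \<noteq> 0" "1 - of_real l * w \<noteq> 0" "1 + of_real l * w \<noteq> 0" if "w \<in> ?H" for w
    using nr[OF that] by (metis nonpos_Reals_zero_I)+
  have "g holomorphic_on ?H"
    unfolding g_def using nr nz by (intro holomorphic_intros) auto
  then obtain f where f: "\<And>w. w \<in> ?H \<Longrightarrow> (f has_field_derivative g w) (at w within ?H)"
    using holomorphic_convex_primitive'[OF convex_halfspace_Im_gt open_halfspace_Im_gt] by metis
  have f': "(f has_field_derivative g w) (at w)" if "w \<in> ?H" for w
    using f[OF that] at_within_open[OF that open_halfspace_Im_gt] by simp
  define q where "q z = g (cx_sn l z) * (cx_cn l z * cx_dn l z)" for z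
  have q2: "q z = 1 \<or> q z = - 1" if z: "z \<in> sn_rectangle l" for z
  proof -
    let ?w = "cx_sn l z"
    have w: "?w \<in> ?H" using cx_sn_upper[OF z] by simp
    have r: "(cx_cn l z)\<^sup>2 = 1 - ?w\<^sup>2" "(cx_dn l z)\<^sup>2 = 1 - (of_real l)\<^sup>2 * ?w\<^sup>2"
      using cx_sn_cn_dn_relations[of z] sn_rectangle_pos(5)[OF z] by auto
    have "(q z)\<^sup>2 = (1 / ((1 - ?w) * (1 + ?w) * (1 - of_real l * ?w) * (1 + of_real l * ?w))) * ((1 - ?w\<^sup>2) * (1 - (of_real l)\<^sup>2 * ?w\<^sup>2))"
      by (simp add: q_def g_def power_mult_distrib power_divide r)
    also have "(1 - ?w\<^sup>2) * (1 - (of_real l)\<^sup>2 * ?w\<^sup>2) = (1 - ?w) * (1 + ?w) * (1 - of_real l * ?w) * (1 + of_real l * ?w)"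
      by (simp add: power2_eq_square algebra_simps)
    also have "(1 / \<dots>) * \<dots> = 1" using nz[OF w] by simp
    finally show ?thesis by (simp add: power2_eq_1_iff)
  qed
  have h: "((f \<circ> cx_sn l) has_field_derivative q z) (at z)" if z: "z \<in> sn_rectangle l" for z
    unfolding q_def
    by (rule DERIV_chain [OF f' cx_sn_deriv]) (use cx_sn_upper[OF z] sn_rectangle_pos(5)[OF z] in auto)
  have "q holomorphic_on (sn_rectangle l)"
  proof (rule holomorphic_transform)
    have "(f \<circ> cx_sn l) holomorphic_on (sn_rectangle l)"
      using h by (auto simp: holomorphic_on_def field_differentiable_def intro: has_field_derivative_at_within)
    thus "deriv (f \<circ> cx_sn l) holomorphic_on (sn_rectangle l)" by (rule holomorphic_deriv [OF _ sn_rectangle_open_convex(1)])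
  qed (use h in \<open>auto intro: DERIV_imp_deriv\<close>)
  hence "continuous_on (sn_rectangle l) q" by (rule holomorphic_on_imp_continuous_on)
  moreover have "finite (q ` (sn_rectangle l))"
    by (rule finite_subset[of _ "{1, -1}"]) (use q2 in auto)
  ultimately have "q constant_on (sn_rectangle l)"
    using sn_rectangle_open_convex(2) by (intro continuous_finite_range_constant convex_connected)
  then obtain e where e: "\<And>z. z \<in> (sn_rectangle l) \<Longrightarrow> q z = e" unfolding constant_on_def by blast
  have "((\<lambda>z. (f \<circ> cx_sn l) z - e * z) has_field_derivative 0) (at z within (sn_rectangle l))" if z: "z \<in> sn_rectangle l" for z
  proof -
    have "((\<lambda>z. (f \<circ> cx_sn l) z - e * z) has_field_derivative q z - e * 1) (at z)"
      by (rule DERIV_diff [OF h[OF z] DERIV_cmult [OF DERIV_ident]])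
    thus ?thesis using e[OF z] by (simp add: has_field_derivative_at_within)
  qed
  then obtain c where c: "\<And>z. z \<in> (sn_rectangle l) \<Longrightarrow> (f \<circ> cx_sn l) z - e * z = c"
    using has_field_derivative_zero_constant[OF sn_rectangle_open_convex(2)] by metis
  show ?thesis
  proof (rule inj_onI)
    fix z w assume zw: "z \<in> sn_rectangle l" "w \<in> (sn_rectangle l)" "cx_sn l z = cx_sn l w"
    hence "e * z = e * w" using c[OF zw(1)] c[OF zw(2)] by (simp add: algebra_simps)
    moreover have "e \<noteq> 0" using q2[OF zw(1)] e[OF zw(1)] by auto
    ultimately show "z = w" by simp
  qed
qed

text \<open>The image is open. It is closed in the upper half-plane because \<open>sn\<close> is real or infinite on the boundary of
  the rectangle.\<close>

lemma cx_sn_onto: "cx_sn l ` (sn_rectangle l) = {w. 0 < Im w}"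
proof -
  let ?H = "{w. 0 < Im w}" and ?T = "cx_sn l ` (sn_rectangle l)"
  have K: "0 < elliptic_K l" "0 < elliptic_K' l"
    using elliptic_K_pos[OF l0 l(2)] elliptic_K_pos[OF m0 m(2)] by (auto simp: K')
  have sub: "?T \<subseteq> ?H" using cx_sn_upper by auto
  have "open ?T" by (rule open_mapping_thm3 [OF cx_sn_holomorphic sn_rectangle_open_convex(1) cx_sn_inj])
  hence 1: "openin (top_of_set ?H) ?T" using sub by (simp add: open_subset)
  have limit: "W \<in> ?T" if W: "0 < Im W" and cl: "W \<in> closure ?T" for W
  proof -
    obtain w where w: "\<And>n. w n \<in> ?T" and lim: "w \<longlonglongrightarrow> W"
      using cl unfolding closure_sequential by blast
    from w have "\<exists>u. \<forall>n. u n \<in> (sn_rectangle l) \<and> w n = cx_sn l (u n)" by (auto intro!: choice)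
    then obtain u where u: "\<And>n. u n \<in> (sn_rectangle l)" "\<And>n. w n = cx_sn l (u n)" by blast
    let ?C = "cbox (Complex (- elliptic_K l) 0) (Complex (elliptic_K l) (elliptic_K' l))"
    have "\<And>n. u n \<in> ?C" using u(1) box_subset_cbox unfolding sn_rectangle_eq_box by blast
    then obtain U r where U: "U \<in> ?C" "strict_mono (r :: nat \<Rightarrow> nat)" "(u \<circ> r) \<longlonglongrightarrow> U"
      using compact_cbox[of "Complex (- elliptic_K l) 0"] unfolding compact_def by metis
    have limr: "(\<lambda>n. w (r n)) \<longlonglongrightarrow> W" using LIMSEQ_subseq_LIMSEQ[OF lim U(2)] by (simp add: o_def)
    have contU: "(\<lambda>n. f (u (r n))) \<longlonglongrightarrow> f U" if "continuous_on UNIV f" for f :: "complex \<Rightarrow> real"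
      using continuous_on_tendsto_compose[OF that, of "\<lambda>n. u (r n)" U sequentially] U(3) by (simp add: o_def)
    have q: "(\<lambda>n. jacobi_denom l (u (r n))) \<longlonglongrightarrow> jacobi_denom l U"
      by (rule contU [OF jacobi_denom_continuous])
    \<comment> \<open>at a zero of the denominator, \<open>sn\<close> would tend to infinity instead of \<open>W\<close>\<close>
    have nz: "jacobi_denom l U \<noteq> 0"
    proof
      assume z: "jacobi_denom l U = 0"
      have "(\<lambda>n. (cmod (w (r n)))\<^sup>2 * jacobi_denom l (u (r n))) \<longlonglongrightarrow> (cmod W)\<^sup>2 * 0"
        using q unfolding z by (intro tendsto_intros limr)
      moreover have "(cmod (w (r n)))\<^sup>2 * jacobi_denom l (u (r n)) =
          1 - (re_cn l (Re (u (r n))))\<^sup>2 * (re_cn (sqrt (1 - l\<^sup>2)) (Im (u (r n))))\<^sup>2" for n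
        using sn_rectangle_pos(5)[OF u(1)[of "r n"]] by (simp add: u(2) cx_sn_norm)
      moreover have "(\<lambda>n. 1 - (re_cn l (Re (u (r n))))\<^sup>2 * (re_cn (sqrt (1 - l\<^sup>2)) (Im (u (r n))))\<^sup>2)
          \<longlonglongrightarrow> 1 - (re_cn l (Re U))\<^sup>2 * (re_cn (sqrt (1 - l\<^sup>2)) (Im U))\<^sup>2"
        by (rule contU) (intro continuous_intros cont)
      ultimately have "1 - (re_cn l (Re U))\<^sup>2 * (re_cn (sqrt (1 - l\<^sup>2)) (Im U))\<^sup>2 = 0"
        using LIMSEQ_unique by fastforce
      thus False using z by (simp add: jacobi_denom_eq_0)
    qed
    have "isCont (cx_sn l) U" by (rule DERIV_isCont [OF cx_sn_deriv[OF nz]])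
    hence "(\<lambda>n. cx_sn l (u (r n))) \<longlonglongrightarrow> cx_sn l U"
      using U(3) isCont_tendsto_compose by (force simp: o_def)
    hence WU: "W = cx_sn l U" using limr LIMSEQ_unique by (auto simp: u(2))
    have "U \<in> (sn_rectangle l)"
    proof (rule ccontr)
      assume "U \<notin> (sn_rectangle l)"
      hence "Re U = elliptic_K l \<or> Re U = - elliptic_K l \<or> Im U = 0 \<or> Im U = elliptic_K' l"
        using U(1) by (auto simp: in_cbox_complex_iff sn_rectangle_def)
      hence "re_cn l (Re U) = 0 \<or> re_sn (sqrt (1 - l\<^sup>2)) (Im U) = 0 \<or> re_cn (sqrt (1 - l\<^sup>2)) (Im U) = 0"
        using re_cn_quarter_period[OF l0 l(2)] re_cn_quarter_period[OF m0 m(2)] re_jacobi_0[OF m0 m(2)]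
        by (auto simp: K')
      hence "Im (cx_sn l U) = 0" by (auto simp: cx_sn_def Let_def)
      thus False using W WU by simp
    qed
    thus "W \<in> ?T" using WU by blast
  qed
  have eq: "?H \<inter> closure ?T = ?T"
  proof (rule equalityI)
    show "?H \<inter> closure ?T \<subseteq> ?T" using limit by (intro subsetI) simp
    show "?T \<subseteq> ?H \<inter> closure ?T" using sub closure_subset[of ?T] by (rule Int_greatest)
  qed
  have "closedin (top_of_set ?H) (?H \<inter> closure ?T)" by (rule closedin_closed_Int) simp
  hence 2: "closedin (top_of_set ?H) ?T" by (simp only: eq)
  have "connected ?H" by (intro convex_connected convex_halfspace_Im_gt)
  hence "?T = {} \<or> ?T = ?H" using 1 2 unfolding connected_clopen by blast
  moreover have "Complex 0 (elliptic_K' l / 2) \<in> (sn_rectangle l)" using K by (simp add: sn_rectangle_def)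
  ultimately show ?thesis by blast
qed

lemma cx_sn_bij: "bij_betw (cx_sn l) (sn_rectangle l) {w. 0 < Im w}"
  using cx_sn_inj cx_sn_onto by (simp add: bij_betw_def)

lemma cx_sn_imaginary_axis: "Re z = 0 \<Longrightarrow> Re (cx_sn l z) = 0"
  by (simp add: cx_sn_def Let_def re_jacobi_0[OF l0 l(2)])

end

lemma bij_betw_cayley:
  assumes a: "0 < Im a"
  shows "bij_betw (\<lambda>w. (w - a) / (w - cnj a)) {w. 0 < Im w} (ball 0 1)"
proof -
  have iff: "cmod (w - a) < cmod (w - cnj a) \<longleftrightarrow> 0 < Im w" for w
  proof -
    have "cmod (w - a) < cmod (w - cnj a) \<longleftrightarrow> (Im w - Im a)\<^sup>2 < (Im w + Im a)\<^sup>2"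
      by (simp add: cmod_def)
    also have "\<dots> \<longleftrightarrow> 0 < Im w * Im a" by (simp add: power2_eq_square algebra_simps)
    finally show ?thesis using a by (simp add: zero_less_mult_iff)
  qed
  have aa: "a \<noteq> cnj a" using a by (auto simp: complex_eq_iff)
  show ?thesis
  proof (rule bij_betw_byWitness [where f' = "\<lambda>z. (a - cnj a * z) / (1 - z)"])
    show "(\<lambda>w. (w - a) / (w - cnj a)) ` {w. 0 < Im w} \<subseteq> ball 0 1"
    proof safe
      fix w :: complex assume "0 < Im w"
      hence "cmod (w - a) < cmod (w - cnj a)" by (simp add: iff)
      moreover from this have "0 < cmod (w - cnj a)" by (meson norm_ge_zero le_less_trans)
      ultimately show "(w - a) / (w - cnj a) \<in> ball 0 1" by (simp add: norm_divide)
    qed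
    show "\<forall>w\<in>{w. 0 < Im w}. (a - cnj a * ((w - a) / (w - cnj a))) / (1 - (w - a) / (w - cnj a)) = w"
    proof
      fix w assume "w \<in> {w. 0 < Im w}"
      hence n: "w - cnj a \<noteq> 0" using a by (auto simp: complex_eq_iff)
      have "1 - (w - a) / (w - cnj a) = (a - cnj a) / (w - cnj a)" using n by (simp add: field_simps)
      moreover have "a - cnj a * ((w - a) / (w - cnj a)) = (a - cnj a) * w / (w - cnj a)"
        using n by (simp add: field_simps)
      ultimately show "(a - cnj a * ((w - a) / (w - cnj a))) / (1 - (w - a) / (w - cnj a)) = w"
        using n aa by simp
    qed
    have inv: "(a - cnj a * z) / (1 - z) - a = z * (a - cnj a) / (1 - z)"
      "(a - cnj a * z) / (1 - z) - cnj a = (a - cnj a) / (1 - z)" if "cmod z < 1" for z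
    proof -
      have "1 - z \<noteq> 0" using that by auto
      thus "(a - cnj a * z) / (1 - z) - a = z * (a - cnj a) / (1 - z)"
        "(a - cnj a * z) / (1 - z) - cnj a = (a - cnj a) / (1 - z)" by (simp_all add: field_simps)
    qed
    show "\<forall>z\<in>ball 0 1. ((a - cnj a * z) / (1 - z) - a) / ((a - cnj a * z) / (1 - z) - cnj a) = z"
    proof
      fix z :: complex assume "z \<in> ball 0 1"
      hence z: "cmod z < 1" by simp
      hence "1 - z \<noteq> 0" by auto
      thus "((a - cnj a * z) / (1 - z) - a) / ((a - cnj a * z) / (1 - z) - cnj a) = z"
        unfolding inv[OF z] using aa by simp
    qed
    show "(\<lambda>z. (a - cnj a * z) / (1 - z)) ` ball 0 1 \<subseteq> {w. 0 < Im w}"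
    proof safe
      fix z :: complex assume "z \<in> ball 0 1"
      hence z: "cmod z < 1" by simp
      hence n: "1 - z \<noteq> 0" by auto
      hence "0 < cmod ((a - cnj a) / (1 - z))" using aa by simp
      hence "cmod z * cmod ((a - cnj a) / (1 - z)) < 1 * cmod ((a - cnj a) / (1 - z))"
        using z by (intro mult_strict_right_mono)
      thus "0 < Im ((a - cnj a * z) / (1 - z))"
        unfolding iff [symmetric] inv[OF z] by (simp add: norm_mult norm_divide)
    qed
  qed
qed

text \<open>The rectangle is mapped to the disk by the similarity \<open>\<tau>\<close>, then \<open>sn\<close>, then the Cayley transform that
  vanishes at \<open>a = sn (\<i> K)\<close>. Since \<open>a\<close> is purely imaginary, the Cayley transform has derivative \<open>1 / (2 a)\<close> at \<open>a\<close>.\<close>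

lemma conformal_radius_rectangle_special:
  fixes k l :: real
  assumes k: "k \<ge> 1" and l: "0 < l" "l < 1" and ratio: "elliptic_K l / elliptic_K' l = 1 / (2 * k)"
  shows "2 / conformal_radius (open_rectangle k) (of_real (k - 1)) = rectangle_const l"
proof -
  let ?R = "open_rectangle k" and ?K = "elliptic_K l" and ?v = "complex_of_real (k - 1)"
  have K: "0 < ?K" "0 < elliptic_K' l"
    using elliptic_K_pos[of l] elliptic_K_pos[of "sqrt (1 - l\<^sup>2)"] complementary_modulus[OF l] l by (auto simp: elliptic_K'_def)
  have K': "elliptic_K' l = 2 * k * ?K" using ratio K k by (simp add: field_simps)
  have v: "?v \<in> ?R" using k by (auto simp: mem_open_rectangle)
  define \<tau> where "\<tau> v = \<i> * of_real ?K * (of_real k - v)" for v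
  have \<tau>: "bij_betw \<tau> ?R (sn_rectangle l)"
  proof (rule bij_betw_byWitness [where f' = "\<lambda>u. of_real k + \<i> * u / of_real ?K"])
    show "\<forall>v\<in>?R. of_real k + \<i> * \<tau> v / of_real ?K = v"
      using K(1) by (auto simp: \<tau>_def field_simps)
    show "\<forall>u\<in>sn_rectangle l. \<tau> (of_real k + \<i> * u / of_real ?K) = u"
      using K(1) by (auto simp: \<tau>_def field_simps)
    show "\<tau> ` ?R \<subseteq> sn_rectangle l"
    proof safe
      fix v assume v: "v \<in> ?R"
      have "?K * \<bar>Im v\<bar> < ?K * 1" using v K(1) by (intro mult_strict_left_mono) (auto simp: mem_open_rectangle)
      moreover have "0 < ?K * (k - Re v)" "?K * (k - Re v) < ?K * (2 * k)"
        using v K(1) by (auto simp: mem_open_rectangle abs_less_iff intro!: mult_pos_pos mult_strict_left_mono)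
      ultimately show "\<tau> v \<in> sn_rectangle l"
        using K(1) by (simp add: \<tau>_def sn_rectangle_def K' abs_mult mult_ac)
    qed
    show "(\<lambda>u. of_real k + \<i> * u / of_real ?K) ` sn_rectangle l \<subseteq> ?R"
    proof safe
      fix u assume "u \<in> sn_rectangle l"
      hence u: "\<bar>Re u\<bar> < ?K" "0 < Im u" "Im u < 2 * k * ?K" by (auto simp: sn_rectangle_def K')
      hence "\<bar>Re u / ?K\<bar> < 1" "0 < Im u / ?K" "Im u / ?K < 2 * k" using K(1) by (simp_all add: divide_less_eq)
      thus "of_real k + \<i> * u / of_real ?K \<in> ?R" by (simp add: mem_open_rectangle abs_less_iff)
    qed
  qed
  have d\<tau>: "(\<tau> has_field_derivative - (\<i> * of_real ?K)) (at v)" for v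
    unfolding \<tau>_def by (auto intro!: derivative_eq_intros)
  define u where "u = \<i> * complex_of_real ?K"
  have u: "\<tau> ?v = u" by (simp add: \<tau>_def u_def)
  have uR: "u \<in> sn_rectangle l" using \<tau> v unfolding u [symmetric] by (auto simp: bij_betw_def)
  define a where "a = cx_sn l u"
  have a: "0 < Im a" using cx_sn_upper[OF l uR] by (simp add: a_def)
  have Re_a: "Re a = 0" unfolding a_def by (rule cx_sn_imaginary_axis[OF l]) (simp add: u_def)
  let ?c = "\<lambda>w. (w - a) / (w - cnj a)"
  define \<phi> where "\<phi> = ?c \<circ> (cx_sn l \<circ> \<tau>)"
  have b1: "bij_betw (cx_sn l \<circ> \<tau>) ?R {w. 0 < Im w}" by (rule bij_betw_trans [OF \<tau> cx_sn_bij[OF l]])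
  have bij: "bij_betw \<phi> ?R (ball 0 1)"
    unfolding \<phi>_def by (rule bij_betw_trans [OF b1 bij_betw_cayley[OF a]])
  have dsn: "(cx_sn l has_field_derivative cx_cn l z * cx_dn l z) (at z)" if "z \<in> sn_rectangle l" for z
    using cx_sn_deriv[OF l] sn_rectangle_pos(5)[OF l that] by simp
  have d\<phi>: "(\<phi> has_field_derivative ((a - cnj a) / (cx_sn l (\<tau> v) - cnj a)\<^sup>2) *
      (cx_cn l (\<tau> v) * cx_dn l (\<tau> v) * (- (\<i> * of_real ?K)))) (at v)" if v: "v \<in> ?R" for v
    unfolding \<phi>_def
  proof (rule DERIV_chain)
    have \<tau>v: "\<tau> v \<in> sn_rectangle l" using \<tau> v by (auto simp: bij_betw_def)
    show "(cx_sn l \<circ> \<tau> has_field_derivative cx_cn l (\<tau> v) * cx_dn l (\<tau> v) * (- (\<i> * of_real ?K))) (at v)"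
      by (rule DERIV_chain [OF dsn[OF \<tau>v] d\<tau>])
    have "cx_sn l (\<tau> v) - cnj a \<noteq> 0" using cx_sn_upper[OF l \<tau>v] a by (auto simp: complex_eq_iff)
    thus "(?c has_field_derivative (a - cnj a) / (cx_sn l (\<tau> v) - cnj a)\<^sup>2) (at ((cx_sn l \<circ> \<tau>) v))"
      by (auto intro!: derivative_eq_intros simp: power2_eq_square)
  qed
  have hol: "\<phi> holomorphic_on ?R"
    using d\<phi> by (auto simp: holomorphic_on_def field_differentiable_def intro: has_field_derivative_at_within)
  have r: "conformal_radius ?R ?v * cmod (deriv \<phi> ?v) = 1"
  proof (rule conformal_radius_eq_inverse_deriv [OF open_rectangle(1,4,5) v hol bij])
    show "\<phi> ?v = 0" by (simp only: \<phi>_def comp_apply u a_def [symmetric] diff_self div_0)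
  qed
  have d: "cmod (deriv \<phi> ?v) = rectangle_const l / 2"
  proof -
    have a2: "a - cnj a = 2 * a" using Re_a by (simp add: complex_eq_iff)
    have a0: "a \<noteq> 0" using a by auto
    have cu: "cmod u = ?K" using K(1) by (simp add: u_def norm_mult)
    have "deriv \<phi> ?v = ((a - cnj a) / (a - cnj a)\<^sup>2) * (cx_cn l u * cx_dn l u * (- (\<i> * of_real ?K)))"
      using d\<phi>[OF v] by (simp only: u a_def [symmetric] DERIV_imp_deriv)
    also have "\<dots> = (1 / (2 * a)) * (cx_cn l u * cx_dn l u * (- (\<i> * of_real ?K)))"
      unfolding a2 using a0 by (simp add: power2_eq_square)
    finally show ?thesis
      using K(1) unfolding rectangle_const_def Let_def u_def [symmetric]
        jacobi_sn_eq[OF l] jacobi_cn_eq[OF l] jacobi_dn_eq[OF l] a_def [symmetric]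
      by (simp add: norm_mult norm_divide cu mult_ac)
  qed
  have "2 / x = c" if "x * (c / 2) = 1" for x c :: real
    using that by (cases "x = 0") (auto simp: field_simps)
  thus ?thesis using r unfolding d by blast
qed

section \<open>The sharp inequality\<close>

theorem theorem4p7:
  fixes k :: real
  assumes "k \<ge> 1"
  shows "(\<exists>!l. 0 < l \<and> l < 1 \<and> elliptic_K l / elliptic_K' l = 1 / (2 * k)) \<and>
    (\<forall>l. 0 < l \<and> l < 1 \<and> elliptic_K l / elliptic_K' l = 1 / (2 * k) \<longrightarrow>
      (let R = open_rectangle k;
           q = (\<lambda>v. 2 * boundary_dist R v / conformal_radius R v);
           C = rectangle_const l
       in (\<forall>v\<in>R. 1 < q v \<and> q v \<le> C) \<and>
          (\<forall>c>1. \<not> (\<forall>v\<in>R. c < q v)) \<and>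
          (\<forall>c<C. \<not> (\<forall>v\<in>R. q v \<le> c)) \<and>
          (\<forall>v\<in>R. q v = C \<longleftrightarrow> v = complex_of_real (k - 1) \<or> v = - complex_of_real (k - 1))))"
proof (intro conjI allI impI)
  show "\<exists>!l. 0 < l \<and> l < 1 \<and> elliptic_K l / elliptic_K' l = 1 / (2 * k)"
    by (rule elliptic_modulus_ex1) (use assms in auto)
next
  fix l assume "0 < l \<and> l < 1 \<and> elliptic_K l / elliptic_K' l = 1 / (2 * k)"
  hence l: "0 < l" "l < 1" "elliptic_K l / elliptic_K' l = 1 / (2 * k)" by auto
  let ?R = "open_rectangle k" and ?C = "rectangle_const l"
  let ?q = "\<lambda>v. 2 * boundary_dist ?R v / conformal_radius ?R v"
  have C: "2 / conformal_radius ?R (of_real (k - 1)) = ?C"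
    by (rule conformal_radius_rectangle_special [OF assms l])
  have pos: "0 < conformal_radius ?R v" if "v \<in> ?R" for v
    by (rule conformal_radius_pos) (use open_rectangle that in auto)
  have in1: "of_real (k - 1) \<in> ?R" using assms by (auto simp: mem_open_rectangle)
  have lower: "1 < ?q v" if "v \<in> ?R" for v
    using conformal_radius_rectangle_less[OF that] pos[OF that] by (simp add: field_simps)
  have upper: "?q v \<le> ?C" "?q v = ?C \<longleftrightarrow> v = complex_of_real (k - 1) \<or> v = - complex_of_real (k - 1)" if "v \<in> ?R" for v
    using rectangle_ratio[OF assms that] unfolding C by auto
  have sharp_lower: "\<exists>v\<in>?R. ?q v \<le> c" if c: "1 < c" for c
  proof -
    \<comment> \<open>at \<open>\<i> y\<close> the quotient is at most \<open>2 / (1 + y)\<close>\<close>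
    define y where "y = max 0 (2 / c - 1)"
    have y: "0 \<le> y" "y < 1" "2 \<le> c * (1 + y)" using c by (auto simp: y_def max_def field_simps)
    let ?v = "\<i> * complex_of_real y"
    have v: "?v \<in> ?R" using assms y by (simp add: mem_open_rectangle)
    have "2 * boundary_dist ?R ?v = 2 * (1 - y)"
      using boundary_dist_rectangle[OF v] assms y by simp
    also have "\<dots> \<le> (c * (1 + y)) * (1 - y)" using y by (intro mult_right_mono) auto
    also have "\<dots> = c * (1 - y\<^sup>2)" by (simp add: power2_eq_square algebra_simps)
    also have "\<dots> \<le> c * conformal_radius ?R ?v"
      using conformal_radius_rectangle_ge[OF assms, of y] y c by (intro mult_left_mono) auto
    finally have "?q ?v \<le> c" using pos[OF v] by (simp add: field_simps)
    thus ?thesis using v by blast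
  qed
  have attained: "?q (of_real (k - 1)) = ?C" using upper(2)[OF in1] by simp
  show "let R = ?R; q = \<lambda>v. 2 * boundary_dist R v / conformal_radius R v; C = ?C
       in (\<forall>v\<in>R. 1 < q v \<and> q v \<le> C) \<and> (\<forall>c>1. \<not> (\<forall>v\<in>R. c < q v)) \<and>
          (\<forall>c<C. \<not> (\<forall>v\<in>R. q v \<le> c)) \<and>
          (\<forall>v\<in>R. q v = C \<longleftrightarrow> v = complex_of_real (k - 1) \<or> v = - complex_of_real (k - 1))"
    unfolding Let_def
  proof (intro conjI ballI allI impI)
    show "\<not> (\<forall>v\<in>?R. c < ?q v)" if "1 < c" for c using sharp_lower[OF that] by (meson leD)
    show "\<not> (\<forall>v\<in>?R. ?q v \<le> c)" if "c < ?C" for c using attained in1 that by (metis leD)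
  qed (use lower upper in auto)
qed

end
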